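(* Any commutative ring with no middle class is Artinian.
   Context: Rings are associative with identity and modules are unital. For $R$-modules $M,N$, $M$ is $N$-injective if every homomorphism from a submodule of $N$ to $M$ extends to a homomorphism $N\to M$. $M$ is poor if the only $R$-modules $N$ for which $M$ is $N$-injective are the semisimple ones. A commutative ring $R$ has no middle class if every $R$-module is either injective or poor. *)

theory Defs
  imports "HOL-Algebra.Algebra" "HOL-Library.Equipollence"
begin

definition module_hom ::
  "('a, 'r) ring_scheme \<Rightarrow> ('a, 'm, 'x) module_scheme \<Rightarrow> ('a, 'n, 'y) module_scheme \<Rightarrow> ('m \<Rightarrow> 'n) set"
where
  "module_hom R M N = {f \<in> carrier M \<rightarrow> carrier N.
     (\<forall>x\<in>carrier M. \<forall>y\<in>carrier M. f (x \<oplus>\<^bsub>M\<^esub> y) = f x \<oplus>\<^bsub>N\<^esub> f y) \<and>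
     (\<forall>r\<in>carrier R. \<forall>x\<in>carrier M. f (r \<odot>\<^bsub>M\<^esub> x) = r \<odot>\<^bsub>N\<^esub> f x)}"

text \<open>\<open>relatively_injective R N M\<close> reads: \<open>M\<close> is \<open>N\<close>-injective.\<close>

definition relatively_injective ::
  "('a, 'r) ring_scheme \<Rightarrow> ('a, 'n, 'y) module_scheme \<Rightarrow> ('a, 'm, 'x) module_scheme \<Rightarrow> bool"
where
  "relatively_injective R N M \<longleftrightarrow>
     (\<forall>K f. submodule K R N \<and> f \<in> module_hom R (N\<lparr>carrier := K\<rparr>) M \<longrightarrow>
        (\<exists>g\<in>module_hom R N M. \<forall>x\<in>K. g x = f x))"

definition semisimple_module ::
  "('a, 'r) ring_scheme \<Rightarrow> ('a, 'm, 'x) module_scheme \<Rightarrow> bool"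
where
  "semisimple_module R N \<longleftrightarrow>
     (\<forall>K. submodule K R N \<longrightarrow>
        (\<exists>L. submodule L R N \<and> K \<inter> L = {\<zero>\<^bsub>N\<^esub>} \<and> K <+>\<^bsub>N\<^esub> L = carrier N))"

text \<open>
  HOL cannot quantify over types inside a formula, so \<open>every module\<close> has to mean every module
  whose elements come from a fixed type \<open>'m\<close>, the universe.  Once \<open>'m\<close> is large enough to hold
  a copy of \<open>R\<close>, it also holds a copy of every cyclic \<open>R\<close>-module, and then the next two notions
  do not depend on \<open>'m\<close>: injectivity can be tested on \<open>R\<close> alone by Baer's criterion, and poverty
  on cyclic modules, since injectivity domains are closed under submodules and a module is
  semisimple as soon as all its cyclic submodules are.
\<close>

definition injective_module ::
  "('a, 'r) ring_scheme \<Rightarrow> ('a, 'm) module \<Rightarrow> bool"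
where
  "injective_module R M \<longleftrightarrow>
     (\<forall>N :: ('a, 'm) module. module R N \<longrightarrow> relatively_injective R N M)"

definition poor_module ::
  "('a, 'r) ring_scheme \<Rightarrow> ('a, 'm) module \<Rightarrow> bool"
where
  "poor_module R M \<longleftrightarrow>
     (\<forall>N :: ('a, 'm) module. module R N \<and> relatively_injective R N M \<longrightarrow> semisimple_module R N)"

definition no_middle_class :: "'m itself \<Rightarrow> ('a, 'r) ring_scheme \<Rightarrow> bool" where
  "no_middle_class (_ :: 'm itself) R \<longleftrightarrow>
     (\<forall>M :: ('a, 'm) module. module R M \<longrightarrow> injective_module R M \<or> poor_module R M)"

text \<open>
  Restricted to commutative rings, because \<open>ideal\<close> means two-sided ideal.
\<close>

locale artinian_cring = cring +
  assumes descending_chain_condition: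
    "\<lbrakk>\<And>n :: nat. ideal (I n) R; \<And>n. I (Suc n) \<subseteq> I n\<rbrakk> \<Longrightarrow> \<exists>m. \<forall>n\<ge>m. I n = I m"

end

theory Submission
  imports Defs "HOL-Analysis.Complex_Transcendental"
begin

text \<open>
  If an injective module over \<open>R/J\<close> is not injective over \<open>R\<close>, then it is poor over \<open>R\<close>, so \<open>R/J\<close> is
  semisimple.  For the character module of \<open>R/J\<close>, which consists of the additive maps from \<open>R/J\<close> to
  the unit circle, injectivity over \<open>R\<close> means that \<open>R/J\<close> is flat.  Hence for every ideal \<open>J\<close> either
  \<open>R/J\<close> is semisimple or \<open>J\<close> is pure, that is, every \<open>a \<in> J\<close> satisfies \<open>a = a b\<close> for some \<open>b \<in> J\<close>.
  When \<open>e\<close> is a primitive idempotent, this forces \<open>e R\<close> to have at most three ideals: zero, the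
  elements of square zero, and \<open>e R\<close>.

  There is no infinite orthogonal family of idempotents \<open>g i\<close>.  Otherwise let \<open>A\<close> be generated by those
  of even index.  As a module, \<open>A\<close> is not injective, but it is \<open>R/A\<close>-injective, because no nonzero
  element of \<open>A\<close> is killed by \<open>A\<close>; and \<open>R/A\<close> is not semisimple, because of the \<open>g i\<close> of odd index.
  So a descending chain of ideals that does not become stationary cannot exist: it would still not
  become stationary in one of \<open>g R\<close> and \<open>(e - g) R\<close> whenever it does not in \<open>e R\<close>, and splitting
  idempotents could go on forever.

  The character module fits into the universe because a character \<open>h\<close> is determined by the subset of
  \<open>R\<close> that it maps to the half circle \<open>[0, \<pi>)\<close>: the values \<open>h (2^k x) = (h x)^(2^k)\<close> give all binary
  digits of the argument of \<open>h x\<close>.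
\<close>

section \<open>Characters of abelian groups\<close>

text \<open>A \<open>t\<close> other than 1 has no root equal to 1, so every \<open>m\<close>-th
  root serves; for \<open>t = 1\<close> a nontrivial root of unity exists because
  \<open>m \<ge> 2\<close>. The condition \<open>\<theta> \<noteq> 1\<close> later lets a character
  detect a new element.\<close>

lemma unit_root_neq_one:
  fixes t :: complex
  assumes "norm t = 1" "m \<ge> 2"
  obtains \<theta> where "norm \<theta> = 1" "\<theta> ^ m = t" "\<theta> \<noteq> 1"
proof (cases "t = 1")
  case False
  have "cis (Arg t) = t"
    using assms(1) by (metis cis_Arg div_by_1 norm_zero of_real_1 sgn_eq zero_neq_one)
  then have "cis (Arg t / real m) ^ m = t"
    using assms(2) by (simp add: Complex.DeMoivre)
  moreover from this have "cis (Arg t / real m) \<noteq> 1" using False by auto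
  ultimately show ?thesis using that[of "cis (Arg t / real m)"] by simp
next
  case True
  have *: "0 < 2 * pi / real m" "2 * pi / real m < 2 * pi"
    using assms(2) by (auto simp: field_simps)
  have "cis (2 * pi / real m) \<noteq> 1"
  proof
    assume "cis (2 * pi / real m) = 1"
    then have "exp (\<i> * of_real (2 * pi / real m)) = 1" by (simp add: cis_conv_exp)
    then have "Arg2pi 1 = 2 * pi / real m"
      using Arg2pi_unique[of 1 "2 * pi / real m" 1] * by simp
    moreover have "Arg2pi 1 = 0" by (rule Arg2pi_unique[of 1]) auto
    ultimately show False using * by simp
  qed
  moreover have "cis (2 * pi / real m) ^ m = t"
    using assms(2) True by (simp add: Complex.DeMoivre)
  ultimately show ?thesis using that[of "cis (2 * pi / real m)"] by simp
qed

lemma Arg2pi_square: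
  assumes "norm z = 1"
  shows "Arg2pi (z\<^sup>2) = (if Arg2pi z < pi then 2 * Arg2pi z else 2 * Arg2pi z - 2 * pi)"
proof -
  have z: "exp (\<i> * of_real (Arg2pi z)) = z"
    using assms complex_norm_eq_1_exp by blast
  have 1: "exp (\<i> * of_real (2 * Arg2pi z)) = z\<^sup>2"
    by (metis z exp_double mult.left_commute of_real_mult of_real_numeral)
  have "exp (\<i> * of_real (2 * Arg2pi z - 2 * pi)) = exp (\<i> * of_real (2 * Arg2pi z)) / exp (2 * of_real pi * \<i>)"
    unfolding exp_diff[symmetric] by (simp add: right_diff_distrib mult.commute)
  also have "\<dots> = z\<^sup>2" using 1 by simp
  finally have 2: "exp (\<i> * of_real (2 * Arg2pi z - 2 * pi)) = z\<^sup>2" .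
  show ?thesis
    using Arg2pi_ge_0[of z] Arg2pi_lt_2pi[of z]
    by (auto intro!: Arg2pi_unique[of 1] simp: 1 2 simp del: of_real_mult of_real_diff)
qed

text \<open>As long as the iterated squares of \<open>z\<close> and \<open>w\<close> lie in the same
  half circle, doubling the argument wraps around for both or for neither, so the difference of the
  arguments doubles exactly. It always stays below \<open>2 * pi\<close> in absolute value, hence it
  is zero.\<close>

lemma eq_if_same_half_circles:
  fixes z w :: complex
  assumes z: "norm z = 1" and w: "norm w = 1"
    and same: "\<And>k. Arg2pi (z ^ (2 ^ k)) < pi \<longleftrightarrow> Arg2pi (w ^ (2 ^ k)) < pi"
  shows "z = w"
proof -
  have *: "Arg2pi (z ^ (2 ^ k)) - Arg2pi (w ^ (2 ^ k)) = 2 ^ k * (Arg2pi z - Arg2pi w)" for k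
  proof (induction k)
    case (Suc k)
    have "x ^ (2 ^ Suc k) = (x ^ (2 ^ k))\<^sup>2" for x :: complex
      by (simp add: power_mult[symmetric] mult.commute)
    then show ?case
      using Suc same[of k] by (simp add: Arg2pi_square z w norm_power algebra_simps)
  qed simp
  have "\<bar>Arg2pi (z ^ (2 ^ k)) - Arg2pi (w ^ (2 ^ k))\<bar> < 2 * pi" for k
    using Arg2pi_ge_0[of "z ^ (2 ^ k)"] Arg2pi_lt_2pi[of "z ^ (2 ^ k)"]
      Arg2pi_ge_0[of "w ^ (2 ^ k)"] Arg2pi_lt_2pi[of "w ^ (2 ^ k)"] by linarith
  then have bound: "2 ^ k * \<bar>Arg2pi z - Arg2pi w\<bar> < 2 * pi" for k
    unfolding * by (simp add: abs_mult)
  have "Arg2pi z = Arg2pi w"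
  proof (rule ccontr)
    assume "Arg2pi z \<noteq> Arg2pi w"
    then have pos: "\<bar>Arg2pi z - Arg2pi w\<bar> > 0" by simp
    obtain k where "2 * pi / \<bar>Arg2pi z - Arg2pi w\<bar> < 2 ^ k"
      using real_arch_pow[of 2] by auto
    then show False using bound[of k] pos by (simp add: field_simps)
  qed
  then show ?thesis
    using z w by (metis complex_norm_eq_1_exp)
qed

text \<open>A set of pairs is used instead of a function so that Zorn's lemma applies to inclusion.\<close>

definition partial_character :: "('g, 'x) monoid_scheme \<Rightarrow> ('g \<times> complex) set \<Rightarrow> bool"
where
  "partial_character G T \<longleftrightarrow>
     T \<subseteq> carrier G \<times> sphere 0 1 \<and> (\<one>\<^bsub>G\<^esub>, 1) \<in> T \<and>
     (\<forall>x s y t. (x, s) \<in> T \<longrightarrow> (y, t) \<in> T \<longrightarrow> (x \<otimes>\<^bsub>G\<^esub> y, s * t) \<in> T) \<and>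
     (\<forall>x s. (x, s) \<in> T \<longrightarrow> (inv\<^bsub>G\<^esub> x, inverse s) \<in> T) \<and>
     (\<forall>s. (\<one>\<^bsub>G\<^esub>, s) \<in> T \<longrightarrow> s = 1)"

lemma partial_characterD:
  assumes "partial_character G T"
  shows "(x, s) \<in> T \<Longrightarrow> x \<in> carrier G" "(x, s) \<in> T \<Longrightarrow> norm s = 1" "(\<one>\<^bsub>G\<^esub>, 1) \<in> T"
    "(x, s) \<in> T \<Longrightarrow> (y, t) \<in> T \<Longrightarrow> (x \<otimes>\<^bsub>G\<^esub> y, s * t) \<in> T"
    "(x, s) \<in> T \<Longrightarrow> (inv\<^bsub>G\<^esub> x, inverse s) \<in> T"
    "(\<one>\<^bsub>G\<^esub>, s) \<in> T \<Longrightarrow> s = 1"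
  using assms by (auto simp: partial_character_def)

section \<open>Extension of characters from subgroups of an abelian group\<close>

context comm_group
begin

lemma partial_character_int_pow:
  assumes T: "partial_character G T" and x: "(x, s) \<in> T"
  shows "(x [^] (n :: int), s powi n) \<in> T"
proof -
  note T' = partial_characterD[OF T]
  have nat: "(x [^] (n :: nat), s ^ n) \<in> T" for n
  proof (induction n)
    case (Suc n)
    then show ?case using T'(4)[OF Suc x] by (simp add: mult.commute)
  qed (simp add: T'(3))
  have xG: "x \<in> carrier G" using T'(1)[OF x] .
  show ?thesis
  proof (cases "n \<ge> 0")
    case True
    then have "x [^] n = x [^] nat n" "s powi n = s ^ nat n"
      by (simp_all add: power_int_def)
    then show ?thesis using nat by simp
  next
    case False
    then have "x [^] n = inv (x [^] nat (- n))" "s powi n = inverse (s ^ nat (- n))"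
      using xG by (simp_all add: int_pow_neg power_int_def power_inverse)
    then show ?thesis using T'(5)[OF nat[of "nat (- n)"]] by simp
  qed
qed

text \<open>The definition excludes a second value only at the identity; the quotient of two values
  at \<open>x\<close> is a value there.\<close>

lemma partial_character_unique:
  assumes T: "partial_character G T" and "(x, s) \<in> T" "(x, t) \<in> T"
  shows "s = t"
proof -
  note T' = partial_characterD[OF T]
  have "(\<one>, s * inverse t) \<in> T"
    using T'(4)[OF assms(2) T'(5)[OF assms(3)]] T'(1)[OF assms(3)] by simp
  then have "s * inverse t = 1" using T'(6) by blast
  moreover have "t \<noteq> 0" using T'(2)[OF assms(3)] by auto
  ultimately show ?thesis by (simp add: field_simps)
qed

text \<open>The domain is enlarged by the powers of \<open>a\<close>. The value
  \<open>\<theta>\<close> at \<open>a\<close> only has to agree with what \<open>T\<close>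
  prescribes on those powers of \<open>a\<close> that are already in its domain, and the circle has
  enough roots for this.\<close>

lemma partial_character_step:
  assumes T: "partial_character G T" and a: "a \<in> carrier G" and notin: "a \<notin> Domain T"
  obtains T' \<theta> where "partial_character G T'" "T \<subseteq> T'" "(a, \<theta>) \<in> T'" "\<theta> \<noteq> 1"
proof -
  note T' = partial_characterD[OF T]
  obtain \<theta> where \<theta>: "norm \<theta> = 1" "\<theta> \<noteq> 1"
    and ok: "\<And>n s. (a [^] (n :: int), s) \<in> T \<Longrightarrow> s = \<theta> powi n"
  proof (cases "\<exists>m>0. a [^] (m :: nat) \<in> Domain T")
    case False
    have "n = 0" if n: "(a [^] (n :: int), s) \<in> T" for n s
    proof (rule ccontr)
      assume "n \<noteq> 0"
      have "(a [^] (- n), inverse s) \<in> T"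
        using T'(5)[OF n] a by (simp add: int_pow_neg)
      moreover have "a [^] nat \<bar>n\<bar> = (if n \<ge> 0 then a [^] n else a [^] (- n))"
        by (simp add: int_pow_int[symmetric])
      ultimately have "a [^] nat \<bar>n\<bar> \<in> Domain T"
        using n by (metis DomainI)
      moreover have "nat \<bar>n\<bar> > 0" using \<open>n \<noteq> 0\<close> by simp
      ultimately show False using False by blast
    qed
    \<comment> \<open>Only the zeroth power of \<open>a\<close> lies in the domain, so
      \<open>\<theta>\<close> is unconstrained; \<open>-1\<close> is simply a value other than
      1.\<close>
    then have "s = (-1) powi n" if "(a [^] (n :: int), s) \<in> T" for n s
      using that T'(6)[of s] by (metis int_pow_0 power_int_0_right)
    then show ?thesis using that[of "-1"] by simp
  next
    case True
    \<comment> \<open>By division with remainder, every exponent \<open>n\<close> with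
      \<open>a [^] n\<close> in the domain is a multiple of the least positive one, so
      \<open>\<theta> ^ m = t\<close> is the only constraint. Since \<open>a\<close> itself is
      outside the domain, \<open>m\<close> is at least 2 and \<open>\<theta>\<close> can avoid
      1.\<close>
    define m where "m = (LEAST m. m > 0 \<and> a [^] (m :: nat) \<in> Domain T)"
    have m: "m > 0" "a [^] m \<in> Domain T"
      using LeastI_ex[OF True] by (auto simp: m_def)
    have least: "m \<le> k" if "k > 0" "a [^] k \<in> Domain T" for k :: nat
      unfolding m_def using that by (intro Least_le) simp
    have "m \<noteq> 1" using m(2) notin a by auto
    then have "m \<ge> 2" using m(1) by simp
    obtain t where t: "(a [^] m, t) \<in> T" using m(2) by blast
    obtain \<theta> where \<theta>: "norm \<theta> = 1" "\<theta> ^ m = t" "\<theta> \<noteq> 1"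
      using unit_root_neq_one[OF T'(2)[OF t] \<open>m \<ge> 2\<close>] .
    have "s = \<theta> powi n" if n: "(a [^] (n :: int), s) \<in> T" for n s
    proof -
      define q where "q = n div int m"
      define r where "r = n mod int m"
      have nqr: "n = int m * q + r" by (simp add: q_def r_def)
      have r: "0 \<le> r" "r < int m" using m(1) by (simp_all add: r_def)
      have tq: "(a [^] (int m * q), t powi q) \<in> T"
        using partial_character_int_pow[OF T t, of q] a by (simp add: int_pow_pow flip: int_pow_int)
      have "(a [^] n \<otimes> inv (a [^] (int m * q)), s * inverse (t powi q)) \<in> T"
        using T'(4)[OF n T'(5)[OF tq]] .
      moreover have "a [^] n \<otimes> inv (a [^] (int m * q)) = a [^] nat r"
        using a r nqr by (simp add: int_pow_diff[symmetric] flip: int_pow_int)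
      ultimately have "a [^] nat r \<in> Domain T" by auto
      then have "r = 0" using least[of "nat r"] r by (cases "r = 0") auto
      then have "s = t powi q"
        using partial_character_unique[OF T n, of "t powi q"] tq nqr by simp
      also have "\<dots> = \<theta> powi n"
        using nqr \<open>r = 0\<close> \<theta>(2) by (simp add: power_int_mult)
      finally show ?thesis .
    qed
    then show ?thesis using that \<theta> by blast
  qed
  have \<theta>0: "\<theta> \<noteq> 0" using \<theta>(1) by auto
  \<comment> \<open>The character on the subgroup generated by the domain of \<open>T\<close> and
    \<open>a\<close>. It is single-valued because \<open>\<one> = x \<otimes> a [^] n\<close> puts
    \<open>a [^] n\<close> into the domain of \<open>T\<close>, where \<open>ok\<close> determines
    its value.\<close>
  define T1 where "T1 = {(x \<otimes> a [^] n, s * \<theta> powi n) | x s n. (x, s) \<in> T \<and> n \<in> (UNIV :: int set)}"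
  have T1I: "(x \<otimes> a [^] (n :: int), s * \<theta> powi n) \<in> T1" if "(x, s) \<in> T" for x s n
    using that by (auto simp: T1_def)
  have sub: "T \<subseteq> T1"
  proof
    fix z assume "z \<in> T"
    then show "z \<in> T1" using T1I[of "fst z" "snd z" 0] T'(1)[of "fst z" "snd z"] by simp
  qed
  have "(a, \<theta>) \<in> T1" using T1I[OF T'(3), of 1] a by (simp add: int_pow_1)
  moreover have "partial_character G T1"
    unfolding partial_character_def
  proof (intro conjI allI impI)
    show "T1 \<subseteq> carrier G \<times> sphere 0 1"
      using T'(1,2) a \<theta>(1) by (auto simp: T1_def norm_mult norm_power_int)
    show "(\<one>, 1) \<in> T1" using sub T'(3) by blast
  next
    fix x s y t assume "(x, s) \<in> T1" "(y, t) \<in> T1"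
    then obtain x' s' n y' t' k where
      x: "(x', s') \<in> T" "x = x' \<otimes> a [^] (n :: int)" "s = s' * \<theta> powi n" and
      y: "(y', t') \<in> T" "y = y' \<otimes> a [^] (k :: int)" "t = t' * \<theta> powi k"
      by (auto simp: T1_def)
    have "x \<otimes> y = (x' \<otimes> y') \<otimes> a [^] (n + k)"
      using x y T'(1)[OF x(1)] T'(1)[OF y(1)] a by (simp add: int_pow_mult m_ac)
    moreover have "s * t = (s' * t') * \<theta> powi (n + k)"
      using x y \<theta>0 by (simp add: power_int_add)
    ultimately show "(x \<otimes> y, s * t) \<in> T1"
      using T1I[OF T'(4)[OF x(1) y(1)]] by simp
  next
    fix x s assume "(x, s) \<in> T1"
    then obtain x' s' n where
      x: "(x', s') \<in> T" "x = x' \<otimes> a [^] (n :: int)" "s = s' * \<theta> powi n"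
      by (auto simp: T1_def)
    have "inv x = inv x' \<otimes> a [^] (- n)"
      using x T'(1)[OF x(1)] a by (simp add: inv_mult int_pow_neg)
    moreover have "inverse s = inverse s' * \<theta> powi (- n)"
      using x by (simp add: power_int_minus)
    ultimately show "(inv x, inverse s) \<in> T1"
      using T1I[OF T'(5)[OF x(1)]] by simp
  next
    fix s assume "(\<one>, s) \<in> T1"
    then obtain x' s' n where
      x: "(x', s') \<in> T" "\<one> = x' \<otimes> a [^] (n :: int)" "s = s' * \<theta> powi n"
      by (auto simp: T1_def)
    have "a [^] n = inv x'"
      using x(2) T'(1)[OF x(1)] a by (metis int_pow_closed inv_solve_left one_closed r_one inv_closed)
    then have "inverse s' = \<theta> powi n" using ok T'(5)[OF x(1)] by simp
    then show "s = 1" using x(3) T'(2)[OF x(1)] by (metis norm_zero right_inverse zero_neq_one)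
  qed
  ultimately show ?thesis using that sub \<theta>(2) by blast
qed

text \<open>This is the injectivity of the circle as an abelian group: Zorn's lemma gives a maximal
  partial character, and \<open>partial_character_step\<close> shows that its domain is the whole
  group.\<close>

lemma partial_character_extend:
  assumes "partial_character G T"
  obtains h where "\<And>x. x \<in> carrier G \<Longrightarrow> norm (h x) = 1"
    "\<And>x y. x \<in> carrier G \<Longrightarrow> y \<in> carrier G \<Longrightarrow> h (x \<otimes> y) = h x * h y"
    "\<And>x s. (x, s) \<in> T \<Longrightarrow> h x = s"
proof -
  let ?A = "{T'. partial_character G T' \<and> T \<subseteq> T'}"
  have "\<exists>M\<in>?A. \<forall>S\<in>?A. M \<subseteq> S \<longrightarrow> S = M"
  proof (rule subset_Zorn_nonempty)
    show "?A \<noteq> {}" using assms by blast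
  next
    fix C assume ne: "C \<noteq> {}" and chain: "subset.chain ?A C"
    have pc: "partial_character G S" "T \<subseteq> S" if "S \<in> C" for S
      using chain that by (auto simp: subset_chain_def)
    have "partial_character G (\<Union>C)"
      unfolding partial_character_def
    proof (intro conjI allI impI)
      show "\<Union>C \<subseteq> carrier G \<times> sphere 0 1"
        using pc(1) by (fastforce simp: partial_character_def)
      show "(\<one>, 1) \<in> \<Union>C"
        using ne pc(1) by (auto simp: partial_character_def)
    next
      fix x s y t assume "(x, s) \<in> \<Union>C" "(y, t) \<in> \<Union>C"
      then obtain S Y where SY: "S \<in> C" "Y \<in> C" "(x, s) \<in> S" "(y, t) \<in> Y" by blast
      then obtain Z where "Z \<in> C" "(x, s) \<in> Z" "(y, t) \<in> Z"
        using chain unfolding subset_chain_def by (metis subsetD)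
      then show "(x \<otimes> y, s * t) \<in> \<Union>C"
        using partial_characterD(4)[OF pc(1)] by blast
    next
      fix x s assume "(x, s) \<in> \<Union>C"
      then show "(inv x, inverse s) \<in> \<Union>C"
        using partial_characterD(5)[OF pc(1)] by blast
    next
      fix s assume "(\<one>, s) \<in> \<Union>C"
      then show "s = 1" using partial_characterD(6)[OF pc(1)] by blast
    qed
    then show "\<Union>C \<in> ?A" using ne pc(2) by blast
  qed
  then obtain M where "M \<in> ?A" and max: "\<forall>S\<in>?A. M \<subseteq> S \<longrightarrow> S = M" by (elim bexE)
  then have M: "partial_character G M" "T \<subseteq> M" by simp_all
  note M' = partial_characterD[OF M(1)]
  have total: "x \<in> Domain M" if x: "x \<in> carrier G" for x
  proof (rule ccontr)
    assume "x \<notin> Domain M"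
    then obtain T' \<theta> where "partial_character G T'" "M \<subseteq> T'" "(x, \<theta>) \<in> T'"
      using partial_character_step[OF M(1) x] by metis
    moreover from this have "T' = M" using max M(2) by auto
    ultimately show False using \<open>x \<notin> Domain M\<close> by blast
  qed
  define h where "h x = (SOME s. (x, s) \<in> M)" for x
  have h: "(x, h x) \<in> M" if "x \<in> carrier G" for x
    using total[OF that] unfolding h_def by (auto intro: someI)
  show ?thesis
  proof (rule that)
    show "norm (h x) = 1" if "x \<in> carrier G" for x using M'(2) h that by blast
    show "h (x \<otimes> y) = h x * h y" if "x \<in> carrier G" "y \<in> carrier G" for x y
      using that h M'(4) partial_character_unique[OF M(1)] by (meson m_closed)
    show "h x = s" if "(x, s) \<in> T" for x s
      using that M h M'(1) partial_character_unique[OF M(1)] by blast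
  qed
qed

end

section \<open>Baer criteria and the dichotomy\<close>

text \<open>The operations are computed on chosen preimages. An injective \<open>p\<close> yields a
  copy of \<open>M\<close> in another type, and a \<open>p\<close> that identifies elements yields a
  quotient.\<close>

definition image_module ::
  "('m \<Rightarrow> 'n) \<Rightarrow> ('a, 'm, 'x) module_scheme \<Rightarrow> ('a, 'n) module"
where
  "image_module p M =
     (let s = inv_into (carrier M) p in
      \<lparr>carrier = p ` carrier M, monoid.mult = undefined, one = undefined, ring.zero = p \<zero>\<^bsub>M\<^esub>,
       ring.add = (\<lambda>x y. p (s x \<oplus>\<^bsub>M\<^esub> s y)), smult = (\<lambda>r x. p (r \<odot>\<^bsub>M\<^esub> s x))\<rparr>)"

definition regular_module :: "('a, 'r) ring_scheme \<Rightarrow> ('a, 'a) module"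
where
  "regular_module R =
     \<lparr>carrier = carrier R, monoid.mult = (\<otimes>\<^bsub>R\<^esub>), one = \<one>\<^bsub>R\<^esub>, ring.zero = \<zero>\<^bsub>R\<^esub>,
      ring.add = (\<oplus>\<^bsub>R\<^esub>), smult = (\<otimes>\<^bsub>R\<^esub>)\<rparr>"

lemma regular_module_simps [simp]:
  "carrier (regular_module R) = carrier R"
  "ring.zero (regular_module R) = \<zero>\<^bsub>R\<^esub>"
  "ring.add (regular_module R) = (\<oplus>\<^bsub>R\<^esub>)"
  "smult (regular_module R) = (\<otimes>\<^bsub>R\<^esub>)"
  by (simp_all add: regular_module_def)

lemma module_homI:
  assumes "\<And>x. x \<in> carrier M \<Longrightarrow> f x \<in> carrier N"
    and "\<And>x y. x \<in> carrier M \<Longrightarrow> y \<in> carrier M \<Longrightarrow> f (x \<oplus>\<^bsub>M\<^esub> y) = f x \<oplus>\<^bsub>N\<^esub> f y"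
    and "\<And>r x. r \<in> carrier R \<Longrightarrow> x \<in> carrier M \<Longrightarrow> f (r \<odot>\<^bsub>M\<^esub> x) = r \<odot>\<^bsub>N\<^esub> f x"
  shows "f \<in> module_hom R M N"
  using assms by (simp add: module_hom_def)

lemma module_homD:
  assumes "f \<in> module_hom R M N"
  shows "x \<in> carrier M \<Longrightarrow> f x \<in> carrier N"
    and "x \<in> carrier M \<Longrightarrow> y \<in> carrier M \<Longrightarrow> f (x \<oplus>\<^bsub>M\<^esub> y) = f x \<oplus>\<^bsub>N\<^esub> f y"
    and "r \<in> carrier R \<Longrightarrow> x \<in> carrier M \<Longrightarrow> f (r \<odot>\<^bsub>M\<^esub> x) = r \<odot>\<^bsub>N\<^esub> f x"
  using assms by (auto simp: module_hom_def)

lemma module_hom_comp: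
  assumes "f \<in> module_hom R L M" "g \<in> module_hom R M N"
  shows "g \<circ> f \<in> module_hom R L N"
  by (rule module_homI) (use assms in \<open>simp_all add: module_homD\<close>)

lemma module_hom_inv:
  assumes "module R M" "p \<in> module_hom R M N" "bij_betw p (carrier M) (carrier N)"
  shows "inv_into (carrier M) p \<in> module_hom R N M"
proof -
  interpret module R M by fact
  have inv: "inv_into (carrier M) p x \<in> carrier M" "p (inv_into (carrier M) p x) = x"
    if "x \<in> carrier N" for x
    using that assms(3) by (auto simp: bij_betw_def inv_into_into f_inv_into_f)
  have eq: "inv_into (carrier M) p x = y" if "y \<in> carrier M" "p y = x" for x y
    using that assms(3) by (auto simp: bij_betw_def)
  show ?thesis
    by (rule module_homI; (rule eq)?) (simp_all add: inv module_homD[OF assms(2)])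
qed

lemma module_hom_zero:
  assumes "module R M" "module R N" "f \<in> module_hom R M N"
  shows "f \<zero>\<^bsub>M\<^esub> = \<zero>\<^bsub>N\<^esub>"
proof -
  interpret M: module R M by fact
  interpret N: module R N by fact
  have "f (\<zero>\<^bsub>R\<^esub> \<odot>\<^bsub>M\<^esub> \<zero>\<^bsub>M\<^esub>) = \<zero>\<^bsub>R\<^esub> \<odot>\<^bsub>N\<^esub> f \<zero>\<^bsub>M\<^esub>"
    using module_homD[OF assms(3)] by blast
  then show ?thesis
    using module_homD(1)[OF assms(3)] by simp
qed

text \<open>The hypotheses make equality of \<open>p\<close>-values a congruence, so the chosen
  preimages do not matter and the module laws descend from \<open>M\<close>.\<close>

lemma image_module:
  assumes "module R M"
    and add: "\<And>x x' y y'. \<lbrakk>x \<in> carrier M; x' \<in> carrier M; y \<in> carrier M; y' \<in> carrier M;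
          p x = p x'; p y = p y'\<rbrakk> \<Longrightarrow> p (x \<oplus>\<^bsub>M\<^esub> y) = p (x' \<oplus>\<^bsub>M\<^esub> y')"
    and smult: "\<And>r x x'. \<lbrakk>r \<in> carrier R; x \<in> carrier M; x' \<in> carrier M; p x = p x'\<rbrakk>
          \<Longrightarrow> p (r \<odot>\<^bsub>M\<^esub> x) = p (r \<odot>\<^bsub>M\<^esub> x')"
  shows "module R (image_module p M)" and "p \<in> module_hom R M (image_module p M)"
    and "carrier (image_module p M) = p ` carrier M"
proof -
  interpret module R M by fact
  let ?N = "image_module p M"
  show car: "carrier ?N = p ` carrier M"
    by (simp add: image_module_def Let_def)
  have zero: "\<zero>\<^bsub>?N\<^esub> = p \<zero>\<^bsub>M\<^esub>"
    by (simp add: image_module_def Let_def)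
  have inv: "inv_into (carrier M) p (p x) \<in> carrier M" "p (inv_into (carrier M) p (p x)) = p x"
    if "x \<in> carrier M" for x
    using that by (auto intro: inv_into_into f_inv_into_f)
  have add': "p x \<oplus>\<^bsub>?N\<^esub> p y = p (x \<oplus>\<^bsub>M\<^esub> y)" if "x \<in> carrier M" "y \<in> carrier M" for x y
    using that by (auto simp: image_module_def Let_def inv intro!: add)
  have smult': "r \<odot>\<^bsub>?N\<^esub> p x = p (r \<odot>\<^bsub>M\<^esub> x)" if "r \<in> carrier R" "x \<in> carrier M" for r x
    using that by (auto simp: image_module_def Let_def inv intro!: smult)
  show "p \<in> module_hom R M ?N"
    by (rule module_homI) (simp_all add: car add' smult')
  have "abelian_group ?N"
  proof (rule abelian_groupI)
    fix x assume "x \<in> carrier ?N"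
    then obtain x' where x': "x' \<in> carrier M" "x = p x'" by (auto simp: car)
    then have "p (\<ominus>\<^bsub>M\<^esub> x') \<oplus>\<^bsub>?N\<^esub> x = \<zero>\<^bsub>?N\<^esub>"
      by (simp add: add' zero M.l_neg)
    then show "\<exists>y\<in>carrier ?N. y \<oplus>\<^bsub>?N\<^esub> x = \<zero>\<^bsub>?N\<^esub>"
      using x' by (auto simp: car)
  qed (auto simp: car zero add' M.a_ac)
  then show "module R ?N"
    by (intro moduleI is_cring)
      (auto simp: car add' smult' smult_l_distr smult_r_distr smult_assoc1)
qed

lemma submodule_vimage:
  assumes "module R M" "module R N" "p \<in> module_hom R M N" "submodule K R N"
  shows "submodule {x \<in> carrier M. p x \<in> K} R M"
proof -
  interpret M: module R M by fact
  interpret N: module R N by fact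
  note K = N.submoduleE[OF assms(4)]
  note p = module_homD[OF assms(3)]
  have neg: "p (\<ominus>\<^bsub>M\<^esub> x) = \<ominus>\<^bsub>N\<^esub> p x" if "x \<in> carrier M" for x
    using p(3)[of "\<ominus>\<^bsub>R\<^esub> \<one>\<^bsub>R\<^esub>" x] that p(1) by (simp add: M.smult_l_minus N.smult_l_minus)
  have "\<zero>\<^bsub>N\<^esub> \<in> K"
    using K(1-5) by (metis N.M.r_neg all_not_in_conv subsetD)
  then show ?thesis
    by (intro M.submoduleI) (use K p neg in \<open>auto simp: module_hom_zero[OF assms(1-3)]\<close>)
qed

lemma submodule_image:
  assumes "module R M" "module R N" "p \<in> module_hom R M N" "submodule K R M"
  shows "submodule (p ` K) R N"
proof -
  interpret M: module R M by fact
  interpret N: module R N by fact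
  note K = M.submoduleE[OF assms(4)]
  note p = module_homD[OF assms(3)]
  have neg: "p (\<ominus>\<^bsub>M\<^esub> x) = \<ominus>\<^bsub>N\<^esub> p x" if "x \<in> carrier M" for x
    using p(3)[of "\<ominus>\<^bsub>R\<^esub> \<one>\<^bsub>R\<^esub>" x] that p(1) by (simp add: M.smult_l_minus N.smult_l_minus)
  have "\<zero>\<^bsub>M\<^esub> \<in> K"
    using K(1-5) by (metis M.M.r_neg all_not_in_conv subsetD)
  then have zero: "\<zero>\<^bsub>N\<^esub> \<in> p ` K"
    by (metis imageI module_hom_zero[OF assms(1-3)])
  show ?thesis
  proof (rule N.submoduleI)
    fix a b assume "a \<in> p ` K" "b \<in> p ` K"
    then obtain x y where xy: "x \<in> K" "y \<in> K" "a = p x" "b = p y" by blast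
    then have "a \<oplus>\<^bsub>N\<^esub> b = p (x \<oplus>\<^bsub>M\<^esub> y)"
      using p(2)[OF subsetD[OF K(1)] subsetD[OF K(1)]] by simp
    then show "a \<oplus>\<^bsub>N\<^esub> b \<in> p ` K" using K(5) xy by blast
  next
    fix a assume "a \<in> p ` K"
    then obtain x where x: "x \<in> K" "a = p x" by blast
    then have "\<ominus>\<^bsub>N\<^esub> a = p (\<ominus>\<^bsub>M\<^esub> x)"
      using neg[of x] K(1) by auto
    then show "\<ominus>\<^bsub>N\<^esub> a \<in> p ` K" using K(3) x by blast
  next
    fix r a assume r: "r \<in> carrier R" and "a \<in> p ` K"
    then obtain x where x: "x \<in> K" "a = p x" by blast
    then have "r \<odot>\<^bsub>N\<^esub> a = p (r \<odot>\<^bsub>M\<^esub> x)"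
      using p(3)[OF r subsetD[OF K(1)]] by simp
    then show "r \<odot>\<^bsub>N\<^esub> a \<in> p ` K" using K(4)[OF r] x by blast
  qed (use K p zero in auto)
qed

text \<open>For \<open>M\<close> killed by \<open>J\<close> this is Baer's criterion over \<open>R/J\<close>; in general it tests the
  annihilator of \<open>J\<close> in \<open>M\<close>.\<close>

definition baer_above ::
  "('a, 'r) ring_scheme \<Rightarrow> 'a set \<Rightarrow> ('a, 'm, 'x) module_scheme \<Rightarrow> bool"
where
  "baer_above R J M \<longleftrightarrow>
     (\<forall>K f. ideal K R \<and> J \<subseteq> K \<and> f \<in> module_hom R (regular_module R\<lparr>carrier := K\<rparr>) M \<and>
        (\<forall>j\<in>J. f j = \<zero>\<^bsub>M\<^esub>) \<longrightarrow> (\<exists>m\<in>carrier M. \<forall>k\<in>K. f k = k \<odot>\<^bsub>M\<^esub> m))"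

lemma baer_above_iso:
  assumes "module R M" "module R N" "p \<in> module_hom R M N" "bij_betw p (carrier M) (carrier N)"
    and "baer_above R J M"
  shows "baer_above R J N"
  unfolding baer_above_def
proof (intro allI impI, elim conjE)
  fix K f
  let ?q = "inv_into (carrier M) p"
  assume K: "ideal K R" "J \<subseteq> K" and f: "f \<in> module_hom R (regular_module R\<lparr>carrier := K\<rparr>) N"
    and J: "\<forall>j\<in>J. f j = \<zero>\<^bsub>N\<^esub>"
  interpret K: ideal K R by fact
  have q: "?q \<in> module_hom R N M"
    using assms module_hom_inv by blast
  have "?q \<circ> f \<in> module_hom R (regular_module R\<lparr>carrier := K\<rparr>) M"
    using f q by (rule module_hom_comp)
  moreover have "\<forall>j\<in>J. (?q \<circ> f) j = \<zero>\<^bsub>M\<^esub>"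
    using J module_hom_zero[OF assms(2,1) q] by simp
  ultimately obtain m where m: "m \<in> carrier M" "\<forall>k\<in>K. (?q \<circ> f) k = k \<odot>\<^bsub>M\<^esub> m"
    using assms(5) K unfolding baer_above_def by blast
  have "f k = k \<odot>\<^bsub>N\<^esub> p m" if "k \<in> K" for k
  proof -
    have "f k \<in> carrier N" using module_homD(1)[OF f] that by simp
    then have "f k = p (?q (f k))"
      using assms(4) by (metis bij_betw_inv_into_right)
    also have "\<dots> = k \<odot>\<^bsub>N\<^esub> p m"
      using m that module_homD(3)[OF assms(3)] by simp
    finally show ?thesis .
  qed
  then show "\<exists>m\<in>carrier N. \<forall>k\<in>K. f k = k \<odot>\<^bsub>N\<^esub> m"
    using m(1) module_homD(1)[OF assms(3)] by blast
qed

text \<open>Semisimplicity of \<open>R/J\<close>: each ideal \<open>K/J\<close> is generated by an idempotent, the class of \<open>e\<close>.\<close>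

definition semisimple_above :: "('a, 'r) ring_scheme \<Rightarrow> 'a set \<Rightarrow> bool"
where
  "semisimple_above R J \<longleftrightarrow>
     (\<forall>K. ideal K R \<and> J \<subseteq> K \<longrightarrow> (\<exists>e\<in>K. \<forall>k\<in>K. k \<ominus>\<^bsub>R\<^esub> k \<otimes>\<^bsub>R\<^esub> e \<in> J))"

context cring
begin

lemma regular_module: "module R (regular_module R)"
proof (rule moduleI)
  show "abelian_group (regular_module R)"
    by (rule abelian_groupI) (auto simp: a_ac intro: l_neg bexI[of _ "\<ominus> _"])
qed (auto simp: is_cring l_distr r_distr m_assoc)

lemma ideal_imp_submodule:
  assumes "ideal I R"
  shows "submodule I R (regular_module R)"
proof -
  interpret I: ideal I R by fact
  interpret Reg: module R "regular_module R" by (rule regular_module)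
  have neg: "\<ominus>\<^bsub>regular_module R\<^esub> a = \<ominus> a" if "a \<in> carrier R" for a
    using that by (intro Reg.M.minus_equality) (auto simp: l_neg)
  show ?thesis
    by (rule Reg.submoduleI) (auto simp: neg I.I_l_closed)
qed

lemma submodule_imp_ideal:
  assumes "submodule I R (regular_module R)"
  shows "ideal I R"
proof -
  interpret Reg: module R "regular_module R" by (rule regular_module)
  note I = Reg.submoduleE[OF assms]
  have mult: "x \<otimes> a \<in> I" if "a \<in> I" "x \<in> carrier R" for a x
    using I(4)[OF that(2,1)] by simp
  have I': "I \<subseteq> carrier R" using I(1) by simp
  have "\<ominus> a \<in> I" if "a \<in> I" for a
    using mult[of a "\<ominus> \<one>"] that I' by (auto simp: l_minus)
  then have "subgroup I (add_monoid R)"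
    using I by (intro add.subgroupI) (auto simp: a_inv_def)
  then show ?thesis
    using mult I' by (intro idealI ring_axioms) (auto simp: m_comm subset_iff)
qed

lemma ideal_if_closed:
  assumes "I \<subseteq> carrier R" "\<zero> \<in> I" "\<And>a b. a \<in> I \<Longrightarrow> b \<in> I \<Longrightarrow> a \<oplus> b \<in> I"
    "\<And>a x. a \<in> I \<Longrightarrow> x \<in> carrier R \<Longrightarrow> x \<otimes> a \<in> I"
  shows "ideal I R"
proof (rule submodule_imp_ideal)
  interpret Reg: module R "regular_module R" by (rule regular_module)
  have "\<ominus>\<^bsub>regular_module R\<^esub> a \<in> I" if "a \<in> I" for a
    using assms(4)[OF that, of "\<ominus> \<one>"] that assms(1) Reg.smult_l_minus[of \<one> a]
    by (auto simp: subset_iff)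
  then show "submodule I R (regular_module R)"
    using assms by (intro Reg.submoduleI) auto
qed

text \<open>Applied when \<open>k \<oplus> l\<close> is congruent to \<open>\<one>\<close> modulo an
  ideal: then \<open>x \<ominus> x \<otimes> k\<close> is congruent to
  \<open>x \<otimes> l\<close>.\<close>

lemma minus_self_mult_add:
  assumes "x \<in> carrier R" "k \<in> carrier R" "l \<in> carrier R"
  shows "x \<ominus> x \<otimes> k = x \<otimes> l \<oplus> x \<otimes> (\<one> \<ominus> (k \<oplus> l))"
  using assms by algebra

section \<open>Cyclic modules: \<open>N\<close> is a copy of \<open>R/J\<close> with projection
  \<open>p\<close>\<close>

context
  fixes J :: "'a set" and N :: "('a, 'n, 'y) module_scheme" and p
  assumes J: "ideal J R" and N: "module R N"
    and p: "p \<in> module_hom R (regular_module R) N"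
    and surj: "p ` carrier R = carrier N"
    and ker: "\<And>x y. x \<in> carrier R \<Longrightarrow> y \<in> carrier R \<Longrightarrow> p x = p y \<longleftrightarrow> x \<ominus> y \<in> J"
begin

interpretation J: ideal J R by (rule J)
interpretation N: module R N by (rule N)

lemma quotient_map_simps:
  "x \<in> carrier R \<Longrightarrow> p x \<in> carrier N"
  "x \<in> carrier R \<Longrightarrow> y \<in> carrier R \<Longrightarrow> p (x \<oplus> y) = p x \<oplus>\<^bsub>N\<^esub> p y"
  "r \<in> carrier R \<Longrightarrow> x \<in> carrier R \<Longrightarrow> p (r \<otimes> x) = r \<odot>\<^bsub>N\<^esub> p x"
  using module_homD[OF p] by auto

lemma quotient_map_zero_iff: "x \<in> carrier R \<Longrightarrow> p x = \<zero>\<^bsub>N\<^esub> \<longleftrightarrow> x \<in> J"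
  using ker[of x \<zero>] module_hom_zero[OF regular_module N p] by (auto simp: minus_eq)

lemma quotient_map_vimage:
  assumes "submodule K R N"
  shows "ideal {x \<in> carrier R. p x \<in> K} R" "J \<subseteq> {x \<in> carrier R. p x \<in> K}"
proof -
  have "submodule {x \<in> carrier R. p x \<in> K} R (regular_module R)"
    using submodule_vimage[OF regular_module N p assms] by simp
  then show "ideal {x \<in> carrier R. p x \<in> K} R"
    by (rule submodule_imp_ideal)
  have "\<zero>\<^bsub>N\<^esub> \<in> K"
    using N.submoduleE[OF assms] by (metis N.M.r_neg all_not_in_conv subsetD)
  then show "J \<subseteq> {x \<in> carrier R. p x \<in> K}"
    using quotient_map_zero_iff by (metis (no_types, lifting) J.a_Hcarr mem_Collect_eq subsetI)
qed

text \<open>Submodules of \<open>R/J\<close> correspond to ideals above \<open>J\<close>. Pulled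
  back along \<open>p\<close>, a map on \<open>K/J\<close> becomes a map on an ideal that vanishes
  on \<open>J\<close>, hence multiplication by some \<open>m\<close>; this \<open>m\<close> is
  killed by \<open>J\<close>, so multiplication by \<open>m\<close> descends to all of
  \<open>R/J\<close>.\<close>

lemma baer_above_imp_relatively_injective:
  assumes M: "module R M" and "baer_above R J M"
  shows "relatively_injective R N M"
  unfolding relatively_injective_def
proof (intro allI impI, elim conjE)
  interpret M: module R M by fact
  fix K f assume K: "submodule K R N" and f: "f \<in> module_hom R (N\<lparr>carrier := K\<rparr>) M"
  let ?K = "{x \<in> carrier R. p x \<in> K}"
  have NK: "module R (N\<lparr>carrier := K\<rparr>)"
    using submodule.submodule_is_module[OF K N] .
  have "p \<in> module_hom R (regular_module R\<lparr>carrier := ?K\<rparr>) (N\<lparr>carrier := K\<rparr>)"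
    by (rule module_homI) (auto simp: quotient_map_simps)
  then have fp: "f \<circ> p \<in> module_hom R (regular_module R\<lparr>carrier := ?K\<rparr>) M"
    using f by (rule module_hom_comp)
  have fpJ: "(f \<circ> p) j = \<zero>\<^bsub>M\<^esub>" if "j \<in> J" for j
    using that quotient_map_zero_iff[of j] module_hom_zero[OF NK M f] by simp
  have "\<exists>m\<in>carrier M. \<forall>k\<in>?K. (f \<circ> p) k = k \<odot>\<^bsub>M\<^esub> m"
    using assms(2) quotient_map_vimage[OF K] fp fpJ unfolding baer_above_def by blast
  then obtain m where m: "m \<in> carrier M" "\<And>k. k \<in> ?K \<Longrightarrow> f (p k) = k \<odot>\<^bsub>M\<^esub> m"
    by auto
  let ?s = "inv_into (carrier R) p"
  \<comment> \<open>The chosen preimage \<open>?s y\<close> is determined up to \<open>J\<close>,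
    which kills \<open>m\<close>.\<close>
  define g where "g y = ?s y \<odot>\<^bsub>M\<^esub> m" for y
  have Jm: "j \<odot>\<^bsub>M\<^esub> m = \<zero>\<^bsub>M\<^esub>" if "j \<in> J" for j
    using m(2)[of j] fpJ[OF that] quotient_map_vimage(2)[OF K] that by auto
  have g: "g (p r) = r \<odot>\<^bsub>M\<^esub> m" if r: "r \<in> carrier R" for r
  proof -
    have s: "?s (p r) \<in> carrier R" "p (?s (p r)) = p r"
      using r by (auto intro: inv_into_into f_inv_into_f)
    then have "?s (p r) \<ominus> r \<in> J" using ker r by blast
    then have "(?s (p r) \<ominus> r) \<odot>\<^bsub>M\<^esub> m \<oplus>\<^bsub>M\<^esub> r \<odot>\<^bsub>M\<^esub> m = r \<odot>\<^bsub>M\<^esub> m"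
      using Jm r m(1) by simp
    moreover have "?s (p r) = (?s (p r) \<ominus> r) \<oplus> r"
      using s(1) r by algebra
    ultimately show ?thesis
      unfolding g_def using s(1) r m(1) by (metis M.smult_l_distr minus_closed)
  qed
  have "g \<in> module_hom R N M"
  proof (rule module_homI)
    fix x assume "x \<in> carrier N"
    then obtain x' where x: "x' \<in> carrier R" "x = p x'" using surj by blast
    then show "g x \<in> carrier M" by (simp add: g m(1))
    {
      fix r assume "r \<in> carrier R"
      then show "g (r \<odot>\<^bsub>N\<^esub> x) = r \<odot>\<^bsub>M\<^esub> g x"
        using x g[of "r \<otimes> x'"] m(1) by (simp add: g quotient_map_simps M.smult_assoc1)
    next
      fix y assume "y \<in> carrier N"
      then obtain y' where "y' \<in> carrier R" "y = p y'" using surj by blast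
      then show "g (x \<oplus>\<^bsub>N\<^esub> y) = g x \<oplus>\<^bsub>M\<^esub> g y"
        using x g[of "x' \<oplus> y'"] m(1) by (simp add: g quotient_map_simps M.smult_l_distr)
    }
  qed
  moreover have "g x = f x" if "x \<in> K" for x
  proof -
    have "x \<in> carrier N" using N.submoduleE(1)[OF K] that by blast
    then obtain x' where "x' \<in> carrier R" "x = p x'" using surj by blast
    then show ?thesis using m(2)[of x'] g that by simp
  qed
  ultimately show "\<exists>g\<in>module_hom R N M. \<forall>x\<in>K. g x = f x" by blast
qed

text \<open>A map on \<open>K\<close> that vanishes on \<open>J\<close> descends to
  \<open>K/J\<close> and extends to \<open>R/J\<close>; the required \<open>m\<close> is the value
  of the extension at the class of \<open>\<one>\<close>.\<close>

lemma relatively_injective_imp_baer_above: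
  assumes M: "module R M" and inj: "relatively_injective R N M"
  shows "baer_above R J M"
  unfolding baer_above_def
proof (intro allI impI, elim conjE)
  interpret M: module R M by fact
  fix K f assume K: "ideal K R" "J \<subseteq> K"
    and f: "f \<in> module_hom R (regular_module R\<lparr>carrier := K\<rparr>) M" and fJ: "\<forall>j\<in>J. f j = \<zero>\<^bsub>M\<^esub>"
  interpret K: ideal K R by fact
  note f' = module_homD[OF f, simplified]
  have pK: "submodule (p ` K) R N"
    using submodule_image[OF regular_module N p ideal_imp_submodule[OF K(1)]] .
  let ?s = "inv_into K p"
  define h where "h y = f (?s y)" for y
  have h: "h (p k) = f k" if k: "k \<in> K" for k
  proof -
    have s: "?s (p k) \<in> K" "p (?s (p k)) = p k"
      using k by (auto intro: inv_into_into f_inv_into_f)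
    then have sJ: "?s (p k) \<ominus> k \<in> J" using ker k by (metis K.a_Hcarr)
    have "?s (p k) = (?s (p k) \<ominus> k) \<oplus> k"
      using s(1) k K.a_Hcarr by algebra
    then have "f (?s (p k)) = f (?s (p k) \<ominus> k) \<oplus>\<^bsub>M\<^esub> f k"
      using f'(2)[of "?s (p k) \<ominus> k" k] sJ K(2) k by auto
    then show ?thesis
      using fJ sJ f'(1)[OF k] by (simp add: h_def)
  qed
  have "h \<in> module_hom R (N\<lparr>carrier := p ` K\<rparr>) M"
  proof (rule module_homI; simp)
    fix x assume "x \<in> p ` K"
    then obtain x' where x: "x' \<in> K" "x = p x'" by blast
    then show "h x \<in> carrier M" by (simp add: h f'(1))
    {
      fix r assume "r \<in> carrier R"
      then show "h (r \<odot>\<^bsub>N\<^esub> x) = r \<odot>\<^bsub>M\<^esub> h x"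
        using x h[of "r \<otimes> x'"] K.a_Hcarr by (simp add: h quotient_map_simps f' K.I_l_closed)
    next
      fix y assume "y \<in> p ` K"
      then obtain y' where "y' \<in> K" "y = p y'" by blast
      then show "h (x \<oplus>\<^bsub>N\<^esub> y) = h x \<oplus>\<^bsub>M\<^esub> h y"
        using x h[of "x' \<oplus> y'"] K.a_Hcarr by (simp add: h quotient_map_simps f')
    }
  qed
  then obtain g where g: "g \<in> module_hom R N M" "\<forall>x\<in>p ` K. g x = h x"
    using inj pK unfolding relatively_injective_def by blast
  have "f k = k \<odot>\<^bsub>M\<^esub> g (p \<one>)" if "k \<in> K" for k
  proof -
    have "f k = g (p (k \<otimes> \<one>))" using that g h K.a_Hcarr by simp
    also have "\<dots> = k \<odot>\<^bsub>M\<^esub> g (p \<one>)"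
      using that K.a_Hcarr module_homD(3)[OF g(1)] quotient_map_simps by (simp del: r_one)
    finally show ?thesis .
  qed
  then show "\<exists>m\<in>carrier M. \<forall>k\<in>K. f k = k \<odot>\<^bsub>M\<^esub> m"
    using module_homD(1)[OF g(1)] quotient_map_simps(1) by blast
qed

text \<open>Let \<open>L\<close> be a complement of \<open>K/J\<close> and decompose the class of
  \<open>\<one>\<close> as \<open>p k\<close> plus \<open>p l\<close>. For \<open>x\<close> in
  \<open>K\<close> the class of \<open>x \<otimes> l\<close> lies in both summands, so it vanishes,
  and \<open>k\<close> acts as an identity on \<open>K\<close> modulo \<open>J\<close>.\<close>

lemma semisimple_module_imp_semisimple_above:
  assumes "semisimple_module R N"
  shows "semisimple_above R J"
  unfolding semisimple_above_def
proof (intro allI impI, elim conjE)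
  fix K assume K: "ideal K R" "J \<subseteq> K"
  interpret K: ideal K R by fact
  have "submodule (p ` K) R N"
    using submodule_image[OF regular_module N p ideal_imp_submodule[OF K(1)]] .
  then obtain L where L: "submodule L R N" "p ` K \<inter> L = {\<zero>\<^bsub>N\<^esub>}" "p ` K <+>\<^bsub>N\<^esub> L = carrier N"
    using assms unfolding semisimple_module_def by blast
  have "p \<one> \<in> p ` K <+>\<^bsub>N\<^esub> L" using L(3) quotient_map_simps(1) by simp
  then obtain k l' where k: "k \<in> K" and l': "l' \<in> L" and kl': "p \<one> = p k \<oplus>\<^bsub>N\<^esub> l'"
    by (auto simp: set_add_def')
  have "l' \<in> carrier N" using N.submoduleE(1)[OF L(1)] l' by blast
  then obtain l where l: "l \<in> carrier R" "l' = p l" using surj by blast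
  have kR: "k \<in> carrier R" using k by simp
  have kl: "\<one> \<ominus> (k \<oplus> l) \<in> J"
    using ker[of \<one> "k \<oplus> l"] kl' l kR quotient_map_simps(2) by simp
  have "x \<ominus> x \<otimes> k \<in> J" if x: "x \<in> K" for x
  proof -
    have xR: "x \<in> carrier R" using x by simp
    have "p (x \<otimes> l) \<in> p ` K" using x l K.I_r_closed by blast
    moreover have "p (x \<otimes> l) \<in> L"
      using quotient_map_simps(3)[OF xR l(1)] N.submoduleE(4)[OF L(1) xR l'] l by simp
    ultimately have "x \<otimes> l \<in> J"
      using L(2) quotient_map_zero_iff[of "x \<otimes> l"] xR l by blast
    then show ?thesis
      using minus_self_mult_add[OF xR kR l(1)] kl xR by (simp add: J.I_l_closed)
  qed
  then show "\<exists>e\<in>K. \<forall>k\<in>K. k \<ominus> k \<otimes> e \<in> J" using k by blast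
qed

end

section \<open>Copies inside the universe and the resulting dichotomy\<close>

lemma coset_eq_iff:
  assumes "ideal J R" "x \<in> carrier R" "y \<in> carrier R"
  shows "J +> x = J +> y \<longleftrightarrow> x \<ominus> y \<in> J"
proof -
  interpret J: ideal J R by fact
  show ?thesis
    using J.a_rcos_module_minus[OF ring_axioms assms(3,2)] J.a_rcos_self[OF assms(2)]
      J.a_repr_independence'[OF _ assms(3), of x] by blast
qed

text \<open>Cosets are subsets of \<open>R\<close>, so an embedding of the power set also embeds the
  quotient.\<close>

lemma quotient_in_type:
  assumes J: "ideal J R" and "Pow (carrier R) \<lesssim> (UNIV :: 'm set)"
  obtains N :: "('a, 'm) module" and p
  where "module R N" "p \<in> module_hom R (regular_module R) N" "p ` carrier R = carrier N"
    "\<And>x y. x \<in> carrier R \<Longrightarrow> y \<in> carrier R \<Longrightarrow> p x = p y \<longleftrightarrow> x \<ominus> y \<in> J"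
proof -
  interpret J: ideal J R by fact
  interpret Reg: module R "regular_module R" by (rule regular_module)
  obtain \<phi> :: "'a set \<Rightarrow> 'm" where \<phi>: "inj_on \<phi> (Pow (carrier R))"
    using assms(2) by (auto simp: lepoll_def)
  define p where "p x = \<phi> (J +> x)" for x
  have ker: "p x = p y \<longleftrightarrow> x \<ominus> y \<in> J" if "x \<in> carrier R" "y \<in> carrier R" for x y
  proof -
    have "J +> x \<in> Pow (carrier R)" "J +> y \<in> Pow (carrier R)"
      using that a_r_coset_subset_G[OF J.a_subset] by auto
    then show ?thesis
      using \<phi> coset_eq_iff[OF J that] by (auto simp: p_def dest: inj_onD)
  qed
  have add: "p (x \<oplus>\<^bsub>regular_module R\<^esub> y) = p (x' \<oplus>\<^bsub>regular_module R\<^esub> y')"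
    if "x \<in> carrier (regular_module R)" "x' \<in> carrier (regular_module R)"
      "y \<in> carrier (regular_module R)" "y' \<in> carrier (regular_module R)" "p x = p x'" "p y = p y'"
    for x x' y y'
  proof -
    have R: "x \<in> carrier R" "x' \<in> carrier R" "y \<in> carrier R" "y' \<in> carrier R"
      using that by simp_all
    have "(x \<ominus> x') \<oplus> (y \<ominus> y') \<in> J" using that ker by simp
    moreover have "(x \<ominus> x') \<oplus> (y \<ominus> y') = (x \<oplus> y) \<ominus> (x' \<oplus> y')"
      using R by algebra
    ultimately show ?thesis using R ker by simp
  qed
  have smult: "p (r \<odot>\<^bsub>regular_module R\<^esub> x) = p (r \<odot>\<^bsub>regular_module R\<^esub> x')"
    if "r \<in> carrier R" "x \<in> carrier (regular_module R)" "x' \<in> carrier (regular_module R)" "p x = p x'"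
    for r x x'
  proof -
    have R: "r \<in> carrier R" "x \<in> carrier R" "x' \<in> carrier R"
      using that by simp_all
    have "r \<otimes> (x \<ominus> x') \<in> J" using R that(4) ker J.I_l_closed by simp
    moreover have "r \<otimes> (x \<ominus> x') = r \<otimes> x \<ominus> r \<otimes> x'"
      using R by algebra
    ultimately show ?thesis using R ker by simp
  qed
  note im = image_module[OF regular_module add smult]
  show ?thesis
    by (rule that[of "image_module p (regular_module R)" p]) (use im ker in auto)
qed

lemma copy_in_type:
  assumes "module R M" and "carrier M \<lesssim> (UNIV :: 'm set)"
  obtains M' :: "('a, 'm) module" and p
  where "module R M'" "p \<in> module_hom R M M'" "bij_betw p (carrier M) (carrier M')"
proof -
  obtain p :: "_ \<Rightarrow> 'm" where p: "inj_on p (carrier M)"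
    using assms(2) by (auto simp: lepoll_def)
  have im: "module R (image_module p M)" "p \<in> module_hom R M (image_module p M)"
    "carrier (image_module p M) = p ` carrier M"
    by (rule image_module[OF assms(1)]; (drule (2) inj_onD[OF p])+; simp)+
  show ?thesis
    by (rule that[of "image_module p M" p]) (use im p in \<open>auto simp: bij_betw_def\<close>)
qed

text \<open>The Baer condition above \<open>J\<close> makes \<open>M\<close> injective relative to
  \<open>R/J\<close>. If \<open>M\<close> is poor, then \<open>R/J\<close> is semisimple; if
  \<open>M\<close> is injective, it satisfies Baer's criterion over \<open>R\<close>. Copies of
  \<open>M\<close> and \<open>R/J\<close> in the universe make the hypothesis applicable.\<close>

lemma no_middle_class_dichotomy:
  assumes "Pow (carrier R) \<lesssim> (UNIV :: 'm set)" and "no_middle_class TYPE('m) R"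
    and J: "ideal J R" and M: "module R M" and card: "carrier M \<lesssim> (UNIV :: 'm set)"
    and baer: "baer_above R J M"
  shows "semisimple_above R J \<or> baer_above R {\<zero>} M"
proof -
  obtain M' :: "('a, 'm) module" and q where M': "module R M'"
    and q: "q \<in> module_hom R M M'" "bij_betw q (carrier M) (carrier M')"
    using copy_in_type[OF M card] .
  have baer': "baer_above R J M'"
    using baer_above_iso[OF M M' q baer] .
  obtain N :: "('a, 'm) module" and p where N: "module R N"
      "p \<in> module_hom R (regular_module R) N" "p ` carrier R = carrier N"
      "\<And>x y. x \<in> carrier R \<Longrightarrow> y \<in> carrier R \<Longrightarrow> p x = p y \<longleftrightarrow> x \<ominus> y \<in> J"
    using quotient_in_type[OF J assms(1)] by blast
  have inj: "relatively_injective R N M'"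
    using baer_above_imp_relatively_injective[OF J N M' baer'] by simp
  consider "injective_module R M'" | "poor_module R M'"
    using assms(2) M' by (auto simp: no_middle_class_def)
  then show ?thesis
  proof cases
    case 1
    \<comment> \<open>The quotient by the zero ideal is a copy of \<open>R\<close> itself inside the
      universe.\<close>
    obtain N0 :: "('a, 'm) module" and p0 where N0: "module R N0"
      "p0 \<in> module_hom R (regular_module R) N0" "p0 ` carrier R = carrier N0"
      "\<And>x y. x \<in> carrier R \<Longrightarrow> y \<in> carrier R \<Longrightarrow> p0 x = p0 y \<longleftrightarrow> x \<ominus> y \<in> {\<zero>}"
      using quotient_in_type[OF zeroideal assms(1)] by blast
    have "relatively_injective R N0 M'"
      using 1 N0(1) by (simp add: injective_module_def)
    then have "baer_above R {\<zero>} M'"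
      using relatively_injective_imp_baer_above[OF zeroideal N0 M'] by simp
    then have "baer_above R {\<zero>} M"
      using baer_above_iso[OF M' M module_hom_inv[OF M q] bij_betw_inv_into[OF q(2)]] by blast
    then show ?thesis ..
  next
    case 2
    then have "semisimple_module R N"
      using N(1) inj by (simp add: poor_module_def)
    then show ?thesis
      using semisimple_module_imp_semisimple_above[OF J N] by simp
  qed
qed

end

section \<open>Pure ideals and idempotents\<close>

context cring
begin

text \<open>A semisimple \<open>R/J\<close> is von Neumann regular. The ideal \<open>a R + J\<close>
  is generated modulo \<open>J\<close> by an idempotent \<open>e\<close>; as \<open>e\<close> is
  congruent to \<open>a \<otimes> r\<close> and \<open>a\<close> to \<open>a \<otimes> e\<close>,
  the factor \<open>r\<close> serves as \<open>c\<close>.\<close>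

lemma semisimple_above_square:
  assumes "ideal J R" "semisimple_above R J" "a \<in> carrier R"
  obtains c where "c \<in> carrier R" "a \<ominus> a \<otimes> a \<otimes> c \<in> J"
proof -
  interpret J: ideal J R by fact
  define K where "K = {a \<otimes> r \<oplus> j | r j. r \<in> carrier R \<and> j \<in> J}"
  have K_iff: "x \<in> K \<longleftrightarrow> (\<exists>r\<in>carrier R. \<exists>j\<in>J. x = a \<otimes> r \<oplus> j)" for x
    by (auto simp: K_def)
  have "ideal K R"
  proof (rule ideal_if_closed)
    show "K \<subseteq> carrier R" using assms(3) by (auto simp: K_def)
    show "\<zero> \<in> K" using assms(3) unfolding K_iff by (intro bexI[of _ \<zero>]) simp_all
  next
    fix x y assume "x \<in> K" "y \<in> K"
    then obtain r j s k where *: "r \<in> carrier R" "j \<in> J" "s \<in> carrier R" "k \<in> J"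
      "x = a \<otimes> r \<oplus> j" "y = a \<otimes> s \<oplus> k" unfolding K_iff by blast
    have jk: "j \<in> carrier R" "k \<in> carrier R" using * by simp_all
    have "x \<oplus> y = a \<otimes> (r \<oplus> s) \<oplus> (j \<oplus> k)"
      unfolding *(5,6) using *(1,3) jk assms(3) by algebra
    moreover have "r \<oplus> s \<in> carrier R" "j \<oplus> k \<in> J" using * by simp_all
    ultimately show "x \<oplus> y \<in> K" unfolding K_iff by blast
  next
    fix x y assume "x \<in> K" and y: "y \<in> carrier R"
    then obtain r j where *: "r \<in> carrier R" "j \<in> J" "x = a \<otimes> r \<oplus> j" unfolding K_iff by blast
    have j: "j \<in> carrier R" using * by simp
    have "y \<otimes> x = a \<otimes> (y \<otimes> r) \<oplus> y \<otimes> j"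
      unfolding *(3) using *(1) j y assms(3) by algebra
    moreover have "y \<otimes> r \<in> carrier R" "y \<otimes> j \<in> J" using * y J.I_l_closed by simp_all
    ultimately show "y \<otimes> x \<in> K" unfolding K_iff by blast
  qed
  moreover have "J \<subseteq> K"
  proof
    fix j assume j: "j \<in> J"
    then have "j = a \<otimes> \<zero> \<oplus> j" using assms(3) by simp
    then show "j \<in> K" using j unfolding K_iff by blast
  qed
  ultimately obtain e where "e \<in> K" and e: "\<And>k. k \<in> K \<Longrightarrow> k \<ominus> k \<otimes> e \<in> J"
    using assms(2) unfolding semisimple_above_def by blast
  then obtain r j where r: "r \<in> carrier R" "j \<in> J" "e = a \<otimes> r \<oplus> j" unfolding K_iff by blast
  have jR: "j \<in> carrier R" using r by simp
  have "a = a \<otimes> \<one> \<oplus> \<zero>" using assms(3) by simp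
  then have "a \<in> K" unfolding K_iff using J.zero_closed by blast
  then have "a \<ominus> a \<otimes> e \<in> J" by (rule e)
  moreover have "a \<otimes> j \<in> J" using r assms(3) J.I_l_closed by simp
  ultimately have "(a \<ominus> a \<otimes> e) \<oplus> a \<otimes> j \<in> J" by simp
  moreover have "(a \<ominus> a \<otimes> e) \<oplus> a \<otimes> j = a \<ominus> a \<otimes> a \<otimes> r"
    unfolding r(3) using r(1) jR assms(3) by algebra
  ultimately show ?thesis using that r(1) by simp
qed

text \<open>The idempotents \<open>f i - f (i + 1)\<close> are orthogonal; the obstruction is the ideal generated by
  those with even index, which is both the module and the ideal to which the dichotomy is applied.\<close>

lemma no_decreasing_idempotents:
  assumes dichotomy: "\<And>(J :: 'a set) (M :: ('a, 'a) module).
      \<lbrakk>ideal J R; module R M; carrier M \<subseteq> carrier R; baer_above R J M\<rbrakk>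
      \<Longrightarrow> semisimple_above R J \<or> baer_above R {\<zero>} M"
    and f0: "f 0 = \<one>" and fR: "\<And>n :: nat. f n \<in> carrier R" and idem: "\<And>n. f n \<otimes> f n = f n"
    and step: "\<And>n. f n \<otimes> f (Suc n) = f (Suc n)" and neq: "\<And>n. f (Suc n) \<noteq> f n"
  shows False
proof -
  have ff: "f i \<otimes> f j = f j" if "i \<le> j" for i j
    using that
  proof (induction j rule: dec_induct)
    case (step n)
    have "f i \<otimes> f (Suc n) = f i \<otimes> f n \<otimes> f (Suc n)"
      using assms(5)[of n] fR by (simp add: m_assoc)
    then show ?case using step assms(5)[of n] by simp
  qed (rule idem)
  define g where "g i = f i \<ominus> f (Suc i)" for i
  have gR: "g i \<in> carrier R" for i using fR by (simp add: g_def)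
  have gf: "g i \<otimes> f j = \<zero>" if "i < j" for i j
  proof -
    have "g i \<otimes> f j = f i \<otimes> f j \<ominus> f (Suc i) \<otimes> f j"
      unfolding g_def using fR[of i] fR[of j] fR[of "Suc i"] by algebra
    then show ?thesis using ff[of i j] ff[of "Suc i" j] that fR by (simp add: minus_eq r_neg)
  qed
  have gf': "g i \<otimes> f j = g i" if "j \<le> i" for i j
  proof -
    have "g i \<otimes> f j = f j \<otimes> f i \<ominus> f j \<otimes> f (Suc i)"
      unfolding g_def using fR[of i] fR[of j] fR[of "Suc i"] by algebra
    then show ?thesis using ff[of j i] ff[of j "Suc i"] that by (simp add: g_def)
  qed
  have gg: "g j \<otimes> g i = \<zero>" if "i < j" for i j
  proof -
    have "g j \<otimes> g i = g j \<otimes> f i \<ominus> g j \<otimes> f (Suc i)"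
      unfolding g_def[of i] using fR[of i] fR[of "Suc i"] gR[of j] by algebra
    then show ?thesis using gf'[of i j] gf'[of "Suc i" j] that gR by (simp add: minus_eq r_neg)
  qed
  have gg': "g i \<otimes> g j = \<zero>" if "i \<noteq> j" for i j
    using gg[of i j] gg[of j i] that m_comm[OF gR gR] by (cases "i < j") auto
  have ggi: "g i \<otimes> g i = g i" for i
  proof -
    have "g i \<otimes> g i = g i \<otimes> f i \<ominus> g i \<otimes> f (Suc i)"
      unfolding g_def using fR[of i] fR[of "Suc i"] by algebra
    then show ?thesis using gf'[of i i] gf[of i "Suc i"] gR by (simp add: minus_eq)
  qed
  have g0: "g i \<noteq> \<zero>" for i
    using neq[of i] fR r_right_minus_eq[of "f i" "f (Suc i)"] by (auto simp: g_def)

  \<comment> \<open>As \<open>f 0 = \<one>\<close>, an \<open>r\<close> killed by \<open>f n\<close>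
    is the sum of the \<open>r \<otimes> g i\<close> with \<open>i < n\<close>. Thus
    \<open>B\<close> is the ideal generated by all \<open>g i\<close> and \<open>A\<close> the one
    generated by those of even index; annihilators express this without finite sums.\<close>
  define B where "B = {r \<in> carrier R. \<exists>n. r \<otimes> f n = \<zero>}"
  define A where "A = {r \<in> B. \<forall>i. odd i \<longrightarrow> r \<otimes> g i = \<zero>}"
  have BR: "B \<subseteq> carrier R" by (auto simp: B_def)
  have f_ann: "r \<otimes> f j = \<zero>" if "r \<in> carrier R" "r \<otimes> f i = \<zero>" "i \<le> j" for r i j
  proof -
    have "r \<otimes> f j = r \<otimes> (f i \<otimes> f j)" using ff[OF that(3)] by simp
    also have "\<dots> = r \<otimes> f i \<otimes> f j" using that(1) fR by (simp add: m_assoc)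
    finally show ?thesis using that(2) fR by simp
  qed
  have B: "ideal B R"
  proof (rule ideal_if_closed[OF BR])
    show "\<zero> \<in> B" using fR by (auto simp: B_def)
  next
    fix a b assume "a \<in> B" "b \<in> B"
    then obtain n m where "a \<in> carrier R" "b \<in> carrier R" "a \<otimes> f n = \<zero>" "b \<otimes> f m = \<zero>"
      by (auto simp: B_def)
    then have "(a \<oplus> b) \<otimes> f (max n m) = \<zero>"
      using f_ann[of a n "max n m"] f_ann[of b m "max n m"] fR by (simp add: l_distr)
    then show "a \<oplus> b \<in> B" using \<open>a \<in> carrier R\<close> \<open>b \<in> carrier R\<close> by (auto simp: B_def)
  next
    fix a x assume "a \<in> B" "x \<in> carrier R"
    moreover from this obtain n where "a \<in> carrier R" "a \<otimes> f n = \<zero>" by (auto simp: B_def)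
    ultimately have "x \<otimes> a \<otimes> f n = \<zero>" using fR by (simp add: m_assoc)
    then show "x \<otimes> a \<in> B" using \<open>x \<in> carrier R\<close> \<open>a \<in> carrier R\<close> by (auto simp: B_def)
  qed
  interpret B: ideal B R by (rule B)
  have AR: "A \<subseteq> carrier R" using BR by (auto simp: A_def)
  have A: "ideal A R"
  proof (rule ideal_if_closed[OF AR])
    show "\<zero> \<in> A" using gR by (auto simp: A_def)
    show "a \<oplus> b \<in> A" if "a \<in> A" "b \<in> A" for a b
      using that gR BR by (auto simp: A_def l_distr)
    show "x \<otimes> a \<in> A" if "a \<in> A" "x \<in> carrier R" for a x
      using that gR BR by (auto simp: A_def m_assoc B.I_l_closed)
  qed
  interpret A: ideal A R by (rule A)
  have gB: "g i \<in> B" for i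
    unfolding B_def using gf[of i "Suc i"] gR[of i] by blast
  have gA: "g i \<in> A" if "even i" for i
  proof -
    have "g i \<otimes> g j = \<zero>" if "odd j" for j
      using gg'[of i j] that \<open>even i\<close> by blast
    then show ?thesis using gB by (simp add: A_def)
  qed

  \<comment> \<open>Elements of \<open>A\<close> are killed by the \<open>g i\<close> of odd index
    anyway. If the even ones kill \<open>x\<close> too, then \<open>x \<otimes> f i = x\<close> for
    all \<open>i\<close> by induction from \<open>f 0 = \<one>\<close>, whereas some
    \<open>f n\<close> kills \<open>x\<close>.\<close>
  have A_ann: "x = \<zero>" if x: "x \<in> A" and ann: "\<And>i. even i \<Longrightarrow> g i \<otimes> x = \<zero>" for x
  proof -
    have xR: "x \<in> carrier R" using x by simp
    have xg: "x \<otimes> g i = \<zero>" for i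
      using ann[of i] x m_comm[OF xR gR[of i]] by (cases "even i") (auto simp: A_def)
    have "x \<otimes> f i = x" for i
    proof (induction i)
      case (Suc i)
      have "x \<otimes> f (Suc i) = x \<otimes> f i \<ominus> x \<otimes> g i"
        unfolding g_def using fR[of i] fR[of "Suc i"] xR by algebra
      then show ?case using Suc xg xR by (simp add: minus_eq)
    qed (use f0 xR in simp)
    then have xf: "x \<otimes> f i = x" for i .
    obtain n where "x \<otimes> f n = \<zero>" using x unfolding A_def B_def by blast
    then show ?thesis using xf[of n] by simp
  qed

  let ?M = "regular_module R\<lparr>carrier := A\<rparr>"
  have M: "module R ?M"
    using submodule.submodule_is_module[OF ideal_imp_submodule[OF A] regular_module] .
  \<comment> \<open>A map \<open>h\<close> from \<open>K\<close> to \<open>A\<close> that vanishes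
    on \<open>A\<close> is zero: for even \<open>i\<close>,
    \<open>g i \<otimes> h k = h (g i \<otimes> k) = \<zero>\<close>, so \<open>A_ann\<close>
    applies.\<close>
  have "baer_above R A ?M"
    unfolding baer_above_def
  proof (intro allI impI, elim conjE)
    fix K h assume K: "ideal K R" "A \<subseteq> K"
      and h: "h \<in> module_hom R (regular_module R\<lparr>carrier := K\<rparr>) ?M" and hA: "\<forall>j\<in>A. h j = \<zero>\<^bsub>?M\<^esub>"
    interpret K: ideal K R by (rule K(1))
    have "h k = \<zero>" if k: "k \<in> K" for k
    proof (rule A_ann)
      show "h k \<in> A" using module_homD(1)[OF h, of k] k by simp
      fix i :: nat assume "even i"
      then have "g i \<otimes> k \<in> A" using gA k A.I_r_closed by simp
      then show "g i \<otimes> h k = \<zero>"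
        using hA module_homD(3)[OF h gR, of k i] k by simp
    qed
    then have "\<forall>k\<in>K. h k = k \<odot>\<^bsub>?M\<^esub> \<zero>" by simp
    then show "\<exists>m\<in>carrier ?M. \<forall>k\<in>K. h k = k \<odot>\<^bsub>?M\<^esub> m" by (intro bexI[of _ \<zero>]) simp_all
  qed
  then consider "semisimple_above R A" | "baer_above R {\<zero>} ?M"
    using dichotomy[OF A M] AR by auto
  then show False
  proof cases
    case 1
    have "A \<subseteq> B" by (auto simp: A_def)
    then obtain e where e: "e \<in> B" "\<And>k. k \<in> B \<Longrightarrow> k \<ominus> k \<otimes> e \<in> A"
      using 1 B unfolding semisimple_above_def by blast
    from e(1) obtain n where n: "e \<otimes> f n = \<zero>" unfolding B_def by blast
    have eR: "e \<in> carrier R" using subsetD[OF BR e(1)] .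
    \<comment> \<open>An odd index that is at least \<open>n\<close>: then \<open>f n\<close> fixes
      \<open>?g\<close>, so \<open>e\<close> kills it and \<open>?g\<close> would lie in
      \<open>A\<close>, whose elements are killed by every \<open>g i\<close> of odd index,
      including \<open>?g\<close> itself.\<close>
    let ?g = "g (2 * n + 1)"
    have gfn: "?g \<otimes> f n = ?g" by (rule gf') simp
    have "?g \<otimes> e = ?g \<otimes> f n \<otimes> e" by (simp only: gfn)
    also have "\<dots> = ?g \<otimes> (e \<otimes> f n)" using gR[of "2 * n + 1"] fR[of n] eR by algebra
    finally have "?g \<otimes> e = \<zero>" using n gR by simp
    then have "?g \<in> A" using e(2)[OF gB[of "2 * n + 1"]] gR[of "2 * n + 1"] by (simp add: minus_eq)
    then have "?g \<otimes> ?g = \<zero>" by (simp add: A_def)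
    then show False using ggi g0 by simp
  next
    case 2
    \<comment> \<open>Injectivity would make the identity map of \<open>A\<close> multiplication by
      some \<open>m\<close> in \<open>A\<close>, but \<open>m\<close> kills \<open>g (2 * n)\<close>
      as soon as \<open>f n\<close> kills \<open>m\<close>.\<close>
    have "(\<lambda>x. x) \<in> module_hom R ?M ?M" by (auto simp: module_hom_def)
    then obtain m where m: "m \<in> A" "\<And>k. k \<in> A \<Longrightarrow> k = k \<otimes> m"
      using 2[unfolded baer_above_def, rule_format, of A "\<lambda>x. x"] A by auto
    from m(1) obtain n where n: "m \<otimes> f n = \<zero>" unfolding A_def B_def by blast
    have mR: "m \<in> carrier R" using subsetD[OF AR m(1)] .
    let ?g = "g (2 * n)"
    have gfn: "?g \<otimes> f n = ?g" by (rule gf') simp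
    have "?g = ?g \<otimes> f n \<otimes> m" unfolding gfn by (rule m(2)[OF gA]) simp
    also have "\<dots> = ?g \<otimes> (m \<otimes> f n)" using gR[of "2 * n"] fR[of n] mR by algebra
    finally show False using n gR g0[of "2 * n"] by simp
  qed
qed

definition pure_ideal :: "'a set \<Rightarrow> bool"
where
  "pure_ideal J \<longleftrightarrow> (\<forall>a\<in>J. \<exists>b\<in>J. a = a \<otimes> b)"

section \<open>Ideals below a primitive idempotent\<close>

context
  assumes pure_or_semisimple: "\<And>J. ideal J R \<Longrightarrow> pure_ideal J \<or> semisimple_above R J"
begin

context
  fixes e
  assumes e: "e \<in> carrier R" "e \<otimes> e = e"
    and primitive: "\<And>g. \<lbrakk>g \<in> carrier R; g \<otimes> g = g; e \<otimes> g = g\<rbrakk> \<Longrightarrow> g = \<zero> \<or> g = e"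
begin

text \<open>Apply the alternative to the ideal \<open>a\<^sup>2 R\<close>. Purity gives
  \<open>a \<otimes> a = a \<otimes> a \<otimes> g\<close> with \<open>g\<close> in that ideal;
  semisimplicity gives \<open>a = a \<otimes> g\<close> with \<open>g\<close> a multiple of
  \<open>a\<close>. Either way \<open>g\<close> is an idempotent below \<open>e\<close>: if it is
  zero, \<open>a\<close> has square zero, and if it is \<open>e\<close>, then \<open>a\<close>
  divides \<open>e\<close>.\<close>

lemma primitive_square_zero_or_unit:
  assumes a: "a \<in> carrier R" "e \<otimes> a = a"
  shows "a \<otimes> a = \<zero> \<or> (\<exists>c\<in>carrier R. e = a \<otimes> c)"
proof -
  let ?J = "PIdl (a \<otimes> a)"
  have J: "ideal ?J R" using a by (simp add: cgenideal_ideal)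
  have J_iff: "x \<in> ?J \<longleftrightarrow> (\<exists>r\<in>carrier R. x = r \<otimes> (a \<otimes> a))" for x
    by (auto simp: cgenideal_def)
  from pure_or_semisimple[OF J] show ?thesis
  proof
    assume "pure_ideal ?J"
    moreover have "a \<otimes> a \<in> ?J" using a by (simp add: cgenideal_self)
    ultimately obtain b where "b \<in> ?J" "a \<otimes> a = a \<otimes> a \<otimes> b"
      unfolding pure_ideal_def by blast
    then obtain r where r: "r \<in> carrier R" "a \<otimes> a = a \<otimes> a \<otimes> (r \<otimes> (a \<otimes> a))"
      using J_iff[of b] by blast
    define g where "g = r \<otimes> (a \<otimes> a)"
    have gR: "g \<in> carrier R" using r a by (simp add: g_def)
    have "g \<otimes> g = r \<otimes> (a \<otimes> a \<otimes> g)"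
      unfolding g_def using r(1) a(1) by algebra
    then have "g \<otimes> g = g" using r(2) by (simp add: g_def)
    moreover have "e \<otimes> g = r \<otimes> ((e \<otimes> a) \<otimes> a)"
      unfolding g_def using r(1) a(1) e(1) by algebra
    then have "e \<otimes> g = g" by (simp add: a(2) g_def)
    ultimately consider "g = \<zero>" | "g = e" using primitive gR by blast
    then show ?thesis
    proof cases
      case 1
      then have "a \<otimes> a = \<zero>" using r(2) a(1) by (simp add: g_def)
      then show ?thesis ..
    next
      case 2
      then have "e = a \<otimes> (r \<otimes> a)" unfolding g_def using r(1) a(1) by (metis m_lcomm)
      then show ?thesis using r a by blast
    qed
  next
    assume "semisimple_above R ?J"
    then obtain c where c: "c \<in> carrier R" "a \<ominus> a \<otimes> a \<otimes> c \<in> ?J"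
      using semisimple_above_square[OF J _ a(1)] by blast
    then obtain r where r: "r \<in> carrier R" "a \<ominus> a \<otimes> a \<otimes> c = r \<otimes> (a \<otimes> a)"
      using J_iff[of "a \<ominus> a \<otimes> a \<otimes> c"] by blast
    have "a = (a \<ominus> a \<otimes> a \<otimes> c) \<oplus> a \<otimes> a \<otimes> c" using a c(1) by algebra
    also have "\<dots> = a \<otimes> (a \<otimes> (r \<oplus> c))" unfolding r(2) using a(1) c(1) r(1) by algebra
    finally have ag: "a = a \<otimes> (a \<otimes> (r \<oplus> c))" .
    define g where "g = a \<otimes> (r \<oplus> c)"
    have gR: "g \<in> carrier R" using r a c by (simp add: g_def)
    have "g \<otimes> g = (a \<otimes> (a \<otimes> (r \<oplus> c))) \<otimes> (r \<oplus> c)"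
      unfolding g_def using r(1) a(1) c(1) by algebra
    then have "g \<otimes> g = g" using ag by (simp add: g_def)
    moreover have "e \<otimes> g = g" using a e c r by (simp add: g_def flip: m_assoc)
    ultimately consider "g = \<zero>" | "g = e" using primitive gR by blast
    then show ?thesis
    proof cases
      case 1
      then have "a = \<zero>" using ag a(1) by (simp add: g_def)
      then show ?thesis by simp
    next
      case 2
      then have "e = a \<otimes> (r \<oplus> c)" by (simp add: g_def)
      then show ?thesis using r c by blast
    qed
  qed
qed

text \<open>A semisimple \<open>R/J\<close> has no nonzero nilpotents, which puts \<open>y\<close>
  into \<open>J\<close>. Purity of \<open>J\<close> is impossible: it gives
  \<open>x = x \<otimes> (e \<otimes> b)\<close> with \<open>e \<otimes> b\<close> in
  \<open>J\<close>; as \<open>e \<notin> J\<close>, this factor does not divide \<open>e\<close>, so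
  it has square zero, and using it twice gives \<open>x = \<zero>\<close>.\<close>

lemma primitive_square_zero_in_ideal:
  assumes J: "ideal J R" "e \<notin> J" and x: "x \<in> J" "e \<otimes> x = x" "x \<noteq> \<zero>"
    and y: "y \<in> carrier R" "y \<otimes> y = \<zero>"
  shows "y \<in> J"
proof -
  interpret J: ideal J R by fact
  from pure_or_semisimple[OF J(1)] show ?thesis
  proof
    assume "semisimple_above R J"
    then obtain c where c: "c \<in> carrier R" "y \<ominus> y \<otimes> y \<otimes> c \<in> J"
      using semisimple_above_square[OF J(1) _ y(1)] by blast
    then show ?thesis using y by (simp add: minus_eq)
  next
    assume "pure_ideal J"
    then obtain b where b: "b \<in> J" "x = x \<otimes> b"
      using x unfolding pure_ideal_def by blast
    have R: "x \<in> carrier R" "b \<in> carrier R" using x b by simp_all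
    let ?b = "e \<otimes> b"
    have xb: "x = x \<otimes> ?b"
    proof -
      have "x \<otimes> ?b = (e \<otimes> x) \<otimes> b" using R e(1) by algebra
      then show ?thesis using x(2) b(2) by simp
    qed
    have bJ: "?b \<in> J" using b e by (simp add: J.I_l_closed)
    have "?b \<otimes> ?b = \<zero> \<or> (\<exists>c\<in>carrier R. e = ?b \<otimes> c)"
      using R e by (intro primitive_square_zero_or_unit) (simp_all flip: m_assoc)
    moreover have "?b \<otimes> c \<in> J" if "c \<in> carrier R" for c
      using that bJ by (simp add: J.I_r_closed)
    ultimately have "?b \<otimes> ?b = \<zero>" using J(2) by metis
    then have "x \<otimes> ?b \<otimes> ?b = \<zero>" using R e by (simp add: m_assoc)
    then show ?thesis using xb x(3) by simp
  qed
qed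

lemma primitive_chain_stable:
  assumes I: "\<And>n :: nat. ideal (I n) R" and dec: "\<And>m n. m \<le> n \<Longrightarrow> I n \<subseteq> I m"
  shows "\<exists>m. \<forall>n\<ge>m. \<forall>x\<in>I m. e \<otimes> x \<in> I n"
proof -
  have IR: "x \<in> carrier R" if "x \<in> I n" for x n
    using ideal.Icarr[OF I that] .
  have Il: "r \<otimes> x \<in> I n" "x \<otimes> r \<in> I n" if "x \<in> I n" "r \<in> carrier R" for x r n
    using ideal.I_l_closed[OF I that] ideal.I_r_closed[OF I that] .
  \<comment> \<open>The cases follow the possible ideals of \<open>e R\<close>: the chain always
    contains \<open>e\<close>, or eventually meets \<open>e R\<close> in zero, or eventually lies
    strictly between. In the last case each \<open>e \<otimes> x\<close> has square zero, and each
    \<open>I n\<close> contains all elements of square zero.\<close>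
  consider "\<forall>n. e \<in> I n" | n where "\<forall>x\<in>I n. e \<otimes> x = \<zero>"
    | m where "e \<notin> I m" "\<forall>n. \<exists>x\<in>I n. e \<otimes> x \<noteq> \<zero>" by blast
  then show ?thesis
  proof cases
    case 1
    then show ?thesis using Il IR by blast
  next
    case (2 n)
    have "\<zero> \<in> I k" for k
      using additive_subgroup.zero_closed[OF ideal.axioms(1)[OF I]] .
    then show ?thesis using 2 by metis
  next
    case (3 m)
    have "e \<otimes> x \<in> I n" if n: "n \<ge> m" and x: "x \<in> I m" for n x
    proof -
      obtain z where z: "z \<in> I n" "e \<otimes> z \<noteq> \<zero>" using 3(2) by blast
      have eI: "e \<notin> I n" using 3(1) dec[OF n] by blast
      have ee: "e \<otimes> (e \<otimes> w) = e \<otimes> w" if "w \<in> carrier R" for w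
        using that e by (simp flip: m_assoc)
      have "e \<otimes> x \<otimes> (e \<otimes> x) = \<zero> \<or> (\<exists>c\<in>carrier R. e = e \<otimes> x \<otimes> c)"
        using IR[OF x] e ee by (intro primitive_square_zero_or_unit) simp_all
      then have "e \<otimes> x \<otimes> (e \<otimes> x) = \<zero>"
        using 3(1) Il x e(1) by metis
      then show ?thesis
        using primitive_square_zero_in_ideal[OF I eI Il(1)[OF z(1) e(1)] ee[OF IR[OF z(1)]] z(2)]
          e(1) IR[OF x] by simp
    qed
    then show ?thesis by blast
  qed
qed

end

section \<open>Descending chains of ideals and splitting of idempotents\<close>

lemma artinian_if_no_decreasing_idempotents:
  assumes no_chain: "\<And>f :: nat \<Rightarrow> 'a. \<lbrakk>f 0 = \<one>; \<And>n. f n \<in> carrier R; \<And>n. f n \<otimes> f n = f n;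
      \<And>n. f n \<otimes> f (Suc n) = f (Suc n); \<And>n. f (Suc n) \<noteq> f n\<rbrakk> \<Longrightarrow> False"
  shows "artinian_cring R"
proof (unfold_locales)
  fix I :: "nat \<Rightarrow> 'a set"
  assume I: "\<And>n. ideal (I n) R" and Suc: "\<And>n. I (Suc n) \<subseteq> I n"
  have dec: "I n \<subseteq> I m" if "m \<le> n" for m n
    using that by (rule lift_Suc_antimono_le[of I, OF Suc])
  have IR: "x \<in> carrier R" if "x \<in> I n" for x n
    using ideal.Icarr[OF I that] .
  \<comment> \<open>For idempotent \<open>e\<close> this says that the chain of the ideals
    \<open>e I n\<close> becomes stationary.\<close>
  define stable where "stable e \<longleftrightarrow> (\<exists>m. \<forall>n\<ge>m. \<forall>x\<in>I m. e \<otimes> x \<in> I n)" for e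
  let ?idem = "\<lambda>e. e \<in> carrier R \<and> e \<otimes> e = e"
  have descend: "\<exists>g. (?idem g \<and> \<not> stable g) \<and> e \<otimes> g = g \<and> g \<noteq> e"
    if e: "?idem e" "\<not> stable e" for e
  proof -
    \<comment> \<open>The chain is stable below a primitive idempotent, so \<open>e\<close> is not
      primitive and splits as \<open>g\<close> plus \<open>e \<ominus> g\<close>; the chain is
      unstable below one of the two.\<close>
    obtain g where g: "g \<in> carrier R" "g \<otimes> g = g" "e \<otimes> g = g" "g \<noteq> \<zero>" "g \<noteq> e"
      using primitive_chain_stable[of e I] I dec e unfolding stable_def by blast
    let ?h = "e \<ominus> g"
    have "\<not> (stable g \<and> stable ?h)"
    proof
      assume "stable g \<and> stable ?h"
      then obtain m k where m: "\<And>n x. n \<ge> m \<Longrightarrow> x \<in> I m \<Longrightarrow> g \<otimes> x \<in> I n"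
        and k: "\<And>n x. n \<ge> k \<Longrightarrow> x \<in> I k \<Longrightarrow> ?h \<otimes> x \<in> I n"
        unfolding stable_def by blast
      have "e \<otimes> x \<in> I n" if "n \<ge> max m k" "x \<in> I (max m k)" for n x
      proof -
        have "x \<in> I m" "x \<in> I k" using that dec[of m "max m k"] dec[of k "max m k"] by auto
        then have "g \<otimes> x \<oplus> ?h \<otimes> x \<in> I n"
          using m[of n x] k[of n x] that additive_subgroup.a_closed[OF ideal.axioms(1)[OF I]] by simp
        moreover have "g \<otimes> x \<oplus> ?h \<otimes> x = e \<otimes> x"
          using g(1) e(1) IR[OF that(2)] by algebra
        ultimately show ?thesis by simp
      qed
      then show False using e(2) unfolding stable_def by blast
    qed
    moreover have "?idem ?h \<and> e \<otimes> ?h = ?h \<and> ?h \<noteq> e"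
    proof (intro conjI)
      show hR: "?h \<in> carrier R" using e g by simp
      have "?h \<otimes> ?h = e \<otimes> e \<ominus> e \<otimes> g \<ominus> e \<otimes> g \<oplus> g \<otimes> g"
        using e(1) g(1) by algebra
      also have "\<dots> = e \<ominus> g \<ominus> g \<oplus> g" using e(1) g by simp
      also have "\<dots> = ?h" using e(1) g(1) by algebra
      finally show "?h \<otimes> ?h = ?h" .
      have "e \<otimes> ?h = e \<otimes> e \<ominus> e \<otimes> g" using e(1) g(1) by algebra
      then show "e \<otimes> ?h = ?h" using e(1) g by simp
      have "g = e \<ominus> ?h" using e(1) g(1) by algebra
      then show "?h \<noteq> e" using g(1,4) e(1) by (auto simp: minus_eq r_neg)
    qed
    ultimately show ?thesis using g by blast
  qed
  have "stable \<one>"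
  proof (rule ccontr)
    assume "\<not> stable \<one>"
    \<comment> \<open>Dependent choice; the clause for \<open>n = 0\<close> anchors the sequence at
      \<open>\<one>\<close>.\<close>
    then have "\<exists>f. \<forall>n. ((?idem (f n) \<and> \<not> stable (f n)) \<and> (n = 0 \<longrightarrow> f n = \<one>)) \<and>
        (f n \<otimes> f (Suc n) = f (Suc n) \<and> f (Suc n) \<noteq> f n)"
      using descend by (intro dependent_nat_choice) auto
    then obtain f where f: "\<And>n. ?idem (f n)" "f 0 = \<one>"
      "\<And>n. f n \<otimes> f (Suc n) = f (Suc n)" "\<And>n. f (Suc n) \<noteq> f n" by auto
    show False by (rule no_chain[of f]) (use f in auto)
  qed
  then obtain m where m: "\<And>n x. n \<ge> m \<Longrightarrow> x \<in> I m \<Longrightarrow> \<one> \<otimes> x \<in> I n"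
    unfolding stable_def by blast
  have "I n = I m" if "n \<ge> m" for n
    using m[OF that] dec[OF that] IR by auto
  then show "\<exists>m. \<forall>n\<ge>m. I n = I m" by blast
qed

end

end

section \<open>Character modules\<close>

text \<open>Characters of \<open>R/J\<close> are represented as additive characters of
  \<open>R\<close> that are trivial on \<open>J\<close>. The circle is written multiplicatively,
  hence the pointwise product as addition and the constant 1 as zero. The value 1 outside the
  carrier makes equal characters equal as functions.\<close>

definition character_module :: "('a, 'r) ring_scheme \<Rightarrow> 'a set \<Rightarrow> ('a, 'a \<Rightarrow> complex) module"
where
  "character_module R J =
     \<lparr>carrier = {h. (\<forall>x. x \<notin> carrier R \<longrightarrow> h x = 1) \<and> (\<forall>x\<in>carrier R. norm (h x) = 1) \<and>
        (\<forall>x\<in>carrier R. \<forall>y\<in>carrier R. h (x \<oplus>\<^bsub>R\<^esub> y) = h x * h y) \<and> (\<forall>j\<in>J. h j = 1)},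
      monoid.mult = undefined, one = undefined, ring.zero = (\<lambda>_. 1),
      ring.add = (\<lambda>h k x. h x * k x),
      smult = (\<lambda>r h x. if x \<in> carrier R then h (r \<otimes>\<^bsub>R\<^esub> x) else 1)\<rparr>"

lemma character_module_simps [simp]:
  "ring.zero (character_module R J) = (\<lambda>_. 1)"
  "ring.add (character_module R J) h k = (\<lambda>x. h x * k x)"
  "smult (character_module R J) r h = (\<lambda>x. if x \<in> carrier R then h (r \<otimes>\<^bsub>R\<^esub> x) else 1)"
  by (simp_all add: character_module_def)

lemma character_moduleI:
  assumes "\<And>x. x \<notin> carrier R \<Longrightarrow> h x = 1" "\<And>x. x \<in> carrier R \<Longrightarrow> norm (h x) = 1"
    "\<And>x y. x \<in> carrier R \<Longrightarrow> y \<in> carrier R \<Longrightarrow> h (x \<oplus>\<^bsub>R\<^esub> y) = h x * h y" "\<And>j. j \<in> J \<Longrightarrow> h j = 1"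
  shows "h \<in> carrier (character_module R J)"
  using assms by (simp add: character_module_def)

lemma character_moduleD:
  assumes "h \<in> carrier (character_module R J)"
  shows "x \<notin> carrier R \<Longrightarrow> h x = 1" "x \<in> carrier R \<Longrightarrow> norm (h x) = 1"
    "x \<in> carrier R \<Longrightarrow> y \<in> carrier R \<Longrightarrow> h (x \<oplus>\<^bsub>R\<^esub> y) = h x * h y" "j \<in> J \<Longrightarrow> h j = 1"
  using assms by (simp_all add: character_module_def)

context cring
begin

lemma character_module:
  assumes "ideal J R"
  shows "module R (character_module R J)"
proof -
  interpret J: ideal J R by fact
  let ?X = "character_module R J"
  note D = character_moduleD[of _ R J]
  show ?thesis
  proof (rule moduleI[OF is_cring])
    show "abelian_group ?X"
    proof (rule abelian_groupI)
      fix h assume h: "h \<in> carrier ?X"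
      have "(\<lambda>x. inverse (h x)) \<in> carrier ?X"
        by (rule character_moduleI) (simp_all add: D[OF h] norm_inverse)
      moreover have "h x \<noteq> 0" for x
        using D(1,2)[OF h, of x] by (cases "x \<in> carrier R") auto
      ultimately show "\<exists>k\<in>carrier ?X. k \<oplus>\<^bsub>?X\<^esub> h = \<zero>\<^bsub>?X\<^esub>"
        by (intro bexI[of _ "\<lambda>x. inverse (h x)"]) (simp_all add: fun_eq_iff)
    next
      fix h k assume h: "h \<in> carrier ?X" and k: "k \<in> carrier ?X"
      show "h \<oplus>\<^bsub>?X\<^esub> k \<in> carrier ?X"
        by (rule character_moduleI) (simp_all add: D[OF h] D[OF k] norm_mult)
    next
      show "\<zero>\<^bsub>?X\<^esub> \<in> carrier ?X" by (rule character_moduleI) simp_all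
    qed (simp_all add: fun_eq_iff mult_ac)
  next
    fix r h assume r: "r \<in> carrier R" and h: "h \<in> carrier ?X"
    show "r \<odot>\<^bsub>?X\<^esub> h \<in> carrier ?X"
      using r by (intro character_moduleI) (simp_all add: D[OF h] r_distr J.I_l_closed)
  next
    fix r s h assume "r \<in> carrier R" "s \<in> carrier R" and h: "h \<in> carrier ?X"
    then show "(r \<oplus> s) \<odot>\<^bsub>?X\<^esub> h = r \<odot>\<^bsub>?X\<^esub> h \<oplus>\<^bsub>?X\<^esub> s \<odot>\<^bsub>?X\<^esub> h"
      by (auto simp: fun_eq_iff l_distr D[OF h])
  next
    fix r s h assume "r \<in> carrier R" "s \<in> carrier R" and h: "h \<in> carrier ?X"
    then show "(r \<otimes> s) \<odot>\<^bsub>?X\<^esub> h = r \<odot>\<^bsub>?X\<^esub> (s \<odot>\<^bsub>?X\<^esub> h)"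
      by (auto simp: fun_eq_iff m_ac)
  next
    fix h assume h: "h \<in> carrier ?X"
    then show "\<one> \<odot>\<^bsub>?X\<^esub> h = h"
      by (auto simp: fun_eq_iff D[OF h])
  qed (auto simp: fun_eq_iff)
qed

lemma character_module_lepoll:
  "carrier (character_module R J) \<lesssim> Pow (carrier R)"
proof -
  let ?X = "character_module R J"
  let ?enc = "\<lambda>h. {x \<in> carrier R. Arg2pi (h x) < pi}"
  have "inj_on ?enc (carrier ?X)"
  proof (rule inj_onI)
    fix h k assume h: "h \<in> carrier ?X" and k: "k \<in> carrier ?X" and eq: "?enc h = ?enc k"
    show "h = k"
    proof
      fix x
      show "h x = k x"
      proof (cases "x \<in> carrier R")
        case True
        \<comment> \<open>The point \<open>y\<close> is the multiple of \<open>x\<close> by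
          \<open>2 ^ n\<close>. It is the same for both characters, so equality of their codes can
          be read off at \<open>y\<close>.\<close>
        have pow: "\<exists>y\<in>carrier R. h y = h x ^ (2 ^ n) \<and> k y = k x ^ (2 ^ n)" for n
        proof (induction n)
          case (Suc n)
          then obtain y where y: "y \<in> carrier R" "h y = h x ^ (2 ^ n)" "k y = k x ^ (2 ^ n)" by blast
          have "z ^ (2 ^ Suc n) = z ^ (2 ^ n) * z ^ (2 ^ n)" for z :: complex
            by (simp add: mult_2 power_add)
          then show ?case
            using y character_moduleD(3)[OF h y(1,1)] character_moduleD(3)[OF k y(1,1)]
            by (intro bexI[of _ "y \<oplus> y"]) simp_all
        qed (use True in auto)
        show ?thesis
        proof (rule eq_if_same_half_circles)
          fix n
          obtain y where "y \<in> carrier R" "h y = h x ^ (2 ^ n)" "k y = k x ^ (2 ^ n)"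
            using pow by blast
          then show "Arg2pi (h x ^ (2 ^ n)) < pi \<longleftrightarrow> Arg2pi (k x ^ (2 ^ n)) < pi"
            using eq by (metis (mono_tags, lifting) mem_Collect_eq)
        qed (rule character_moduleD(2)[OF h True] character_moduleD(2)[OF k True])+
      qed (simp add: character_moduleD(1)[OF h] character_moduleD(1)[OF k])
    qed
  qed
  then show ?thesis unfolding lepoll_def by (intro exI[of _ ?enc]) blast
qed

lemma additive_character_extend:
  assumes "partial_character (add_monoid R) T"
  obtains h where "\<And>x. x \<in> carrier R \<Longrightarrow> norm (h x) = 1"
    "\<And>x y. x \<in> carrier R \<Longrightarrow> y \<in> carrier R \<Longrightarrow> h (x \<oplus> y) = h x * h y"
    "\<And>x s. (x, s) \<in> T \<Longrightarrow> h x = s"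
  by (rule comm_group.partial_character_extend[OF a_comm_group assms, simplified]) (rule that)

section \<open>Injectivity of character modules over \<open>R/J\<close> and over
  \<open>R\<close>\<close>

text \<open>A homomorphism \<open>f\<close> into the character module is determined by the additive
  character \<open>f k \<one>\<close> of \<open>K\<close>, since
  \<open>f k x = f (x \<otimes> k) \<one>\<close>. This character extends to \<open>R\<close>, and
  the extension is trivial on \<open>J\<close> because \<open>f\<close> is.\<close>

lemma character_module_baer_above:
  assumes J: "ideal J R"
  shows "baer_above R J (character_module R J)"
  unfolding baer_above_def
proof (intro allI impI, elim conjE)
  let ?X = "character_module R J"
  fix K f assume K: "ideal K R" "J \<subseteq> K"
    and f: "f \<in> module_hom R (regular_module R\<lparr>carrier := K\<rparr>) ?X"
    and fJ: "\<forall>j\<in>J. f j = \<zero>\<^bsub>?X\<^esub>"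
  interpret J: ideal J R by fact
  interpret K: ideal K R by fact
  have fX: "f k \<in> carrier ?X" if "k \<in> K" for k
    using module_homD(1)[OF f] that by simp
  have f_add: "f (k \<oplus> l) = (\<lambda>x. f k x * f l x)" if "k \<in> K" "l \<in> K" for k l
    using module_homD(2)[OF f, of k l] that by simp
  have f_mult: "f (r \<otimes> k) = (\<lambda>x. if x \<in> carrier R then f k (r \<otimes> x) else 1)"
    if "r \<in> carrier R" "k \<in> K" for r k
    using module_homD(3)[OF f, of r k] that by simp
  have f0: "f \<zero> = (\<lambda>_. 1)" using fJ J.zero_closed by auto
  define T where "T = (\<lambda>k. (k, f k \<one>)) ` K"
  have "partial_character (add_monoid R) T"
    unfolding partial_character_def
  proof (intro conjI allI impI)
    show "T \<subseteq> carrier (add_monoid R) \<times> sphere 0 1"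
      using character_moduleD(2)[OF fX one_closed] by (auto simp: T_def)
    show "(\<one>\<^bsub>add_monoid R\<^esub>, 1) \<in> T"
      using f0 K.zero_closed by (auto simp: T_def image_iff)
  next
    fix x s y t assume "(x, s) \<in> T" "(y, t) \<in> T"
    then show "(x \<otimes>\<^bsub>add_monoid R\<^esub> y, s * t) \<in> T"
      by (auto simp: T_def image_iff f_add)
  next
    fix x s assume "(x, s) \<in> T"
    then have x: "x \<in> K" "s = f x \<one>" by (auto simp: T_def)
    have "f x \<one> * f (\<ominus> x) \<one> = 1"
      using fun_cong[OF f_add[of x "\<ominus> x"], of \<one>] x f0 by (simp add: r_neg)
    then have "inverse s = f (\<ominus> x) \<one>" unfolding x(2) by (rule inverse_unique)
    moreover have "\<ominus> x \<in> K" using x by simp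
    ultimately show "(inv\<^bsub>add_monoid R\<^esub> x, inverse s) \<in> T"
      by (simp add: T_def a_inv_def)
  next
    fix s assume "(\<one>\<^bsub>add_monoid R\<^esub>, s) \<in> T"
    then show "s = 1" using f0 by (auto simp: T_def)
  qed
  then obtain h where h: "\<And>x. x \<in> carrier R \<Longrightarrow> norm (h x) = 1"
    "\<And>x y. x \<in> carrier R \<Longrightarrow> y \<in> carrier R \<Longrightarrow> h (x \<oplus> y) = h x * h y"
    "\<And>x s. (x, s) \<in> T \<Longrightarrow> h x = s"
    by (rule additive_character_extend) blast
  have hK: "h k = f k \<one>" if "k \<in> K" for k using h(3) that by (auto simp: T_def)
  define m where "m x = (if x \<in> carrier R then h x else 1)" for x
  have "m \<in> carrier ?X"
    by (rule character_moduleI) (use h K fJ hK in \<open>auto simp: m_def\<close>)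
  moreover have "f k = k \<odot>\<^bsub>?X\<^esub> m" if k: "k \<in> K" for k
  proof
    fix x
    show "f k x = (k \<odot>\<^bsub>?X\<^esub> m) x"
    proof (cases "x \<in> carrier R")
      case True
      have "(k \<odot>\<^bsub>?X\<^esub> m) x = h (k \<otimes> x)" using True k by (simp add: m_def)
      also have "\<dots> = f (x \<otimes> k) \<one>"
        using hK[OF K.I_l_closed[OF k True]] k True by (simp add: m_comm)
      also have "\<dots> = f k x" using f_mult[OF True k] True by simp
      finally show ?thesis by simp
    qed (simp add: character_moduleD(1)[OF fX[OF k]])
  qed
  ultimately show "\<exists>m\<in>carrier ?X. \<forall>k\<in>K. f k = k \<odot>\<^bsub>?X\<^esub> m" by blast
qed

text \<open>If \<open>a\<close> is in \<open>J\<close> but not in \<open>a J\<close>, some character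
  \<open>h\<close> is trivial on \<open>a J\<close> with \<open>h a \<noteq> 1\<close>. Multiples of
  \<open>h\<close> define a map from \<open>a R\<close> to the character module that is not
  multiplication by any of its elements \<open>m\<close>, because \<open>m a = 1\<close>.\<close>

lemma character_module_injective_imp_pure:
  assumes J: "ideal J R" and inj: "baer_above R {\<zero>} (character_module R J)"
  shows "pure_ideal J"
  unfolding pure_ideal_def
proof (rule ballI, rule ccontr)
  let ?X = "character_module R J"
  interpret J: ideal J R by fact
  fix a assume aJ: "a \<in> J" and notin: "\<not> (\<exists>b\<in>J. a = a \<otimes> b)"
  have aR: "a \<in> carrier R" using aJ by simp
  \<comment> \<open>The trivial character on \<open>a J\<close>. Its domain misses \<open>a\<close>,
    so it can be extended with a value other than 1 at \<open>a\<close>.\<close>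
  define T :: "('a \<times> complex) set" where "T = (\<lambda>j. (a \<otimes> j, 1)) ` J"
  have "partial_character (add_monoid R) T"
    unfolding partial_character_def
  proof (intro conjI allI impI)
    show "T \<subseteq> carrier (add_monoid R) \<times> sphere 0 1"
      using aR by (auto simp: T_def)
    show "(\<one>\<^bsub>add_monoid R\<^esub>, 1) \<in> T"
      using aR by (auto simp: T_def intro!: image_eqI[of _ _ \<zero>])
  next
    fix x s y t assume "(x, s) \<in> T" "(y, t) \<in> T"
    then obtain j k where "j \<in> J" "k \<in> J" "x = a \<otimes> j" "y = a \<otimes> k" "s = 1" "t = 1"
      by (auto simp: T_def)
    then show "(x \<otimes>\<^bsub>add_monoid R\<^esub> y, s * t) \<in> T"
      using aR by (auto simp: T_def r_distr intro!: image_eqI[of _ _ "j \<oplus> k"])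
  next
    fix x s assume "(x, s) \<in> T"
    then obtain j where "j \<in> J" "x = a \<otimes> j" "s = 1" by (auto simp: T_def)
    then show "(inv\<^bsub>add_monoid R\<^esub> x, inverse s) \<in> T"
      using aR by (auto simp: T_def r_minus a_inv_def[symmetric] intro!: image_eqI[of _ _ "\<ominus> j"])
  next
    fix s assume "(\<one>\<^bsub>add_monoid R\<^esub>, s) \<in> T"
    then show "s = 1" by (auto simp: T_def)
  qed
  moreover have "a \<notin> Domain T" using notin by (auto simp: T_def)
  ultimately obtain T' \<theta> where T': "partial_character (add_monoid R) T'" "T \<subseteq> T'" "(a, \<theta>) \<in> T'" "\<theta> \<noteq> 1"
    using comm_group.partial_character_step[OF a_comm_group, of T a] aR by auto
  obtain h where h: "\<And>x. x \<in> carrier R \<Longrightarrow> norm (h x) = 1"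
    "\<And>x y. x \<in> carrier R \<Longrightarrow> y \<in> carrier R \<Longrightarrow> h (x \<oplus> y) = h x * h y"
    "\<And>x s. (x, s) \<in> T' \<Longrightarrow> h x = s"
    using T'(1) by (rule additive_character_extend) blast
  have ha: "h a \<noteq> 1" using h(3)[OF T'(3)] T'(4) by simp
  have haJ: "h (a \<otimes> j) = 1" if "j \<in> J" for j
    using h(3)[of "a \<otimes> j" 1] T'(2) that by (auto simp: T_def)
  \<comment> \<open>\<open>f y\<close> is \<open>y\<close> acting on \<open>h\<close>. Although
    \<open>h\<close> need not be trivial on \<open>J\<close>, its multiples by elements of
    \<open>a R\<close> are, because \<open>h\<close> is trivial on \<open>a J\<close>.\<close>
  define f where "f y x = (if x \<in> carrier R then h (y \<otimes> x) else 1)" for y x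
  let ?K = "PIdl a"
  have K: "ideal ?K R" using aR by (rule cgenideal_ideal)
  have K_iff: "x \<in> ?K \<longleftrightarrow> (\<exists>r\<in>carrier R. x = r \<otimes> a)" for x
    by (auto simp: cgenideal_def)
  interpret K: ideal ?K R by (rule K)
  have fX: "f y \<in> carrier ?X" if "y \<in> ?K" for y
  proof (rule character_moduleI)
    have yR: "y \<in> carrier R" using that by simp
    show "f y x = 1" if "x \<notin> carrier R" for x using that by (simp add: f_def)
    show "norm (f y x) = 1" if "x \<in> carrier R" for x using that yR by (simp add: f_def h)
    show "f y (x \<oplus> z) = f y x * f y z" if "x \<in> carrier R" "z \<in> carrier R" for x z
      using that yR by (simp add: f_def h r_distr)
    show "f y j = 1" if j: "j \<in> J" for j
    proof -
      obtain r where r: "r \<in> carrier R" "y = r \<otimes> a" using \<open>y \<in> ?K\<close> K_iff by blast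
      have "y \<otimes> j = a \<otimes> (r \<otimes> j)"
        using r aR j by (simp add: m_ac)
      then show ?thesis using haJ[of "r \<otimes> j"] r(1) j by (simp add: f_def J.I_l_closed)
    qed
  qed
  have "f \<in> module_hom R (regular_module R\<lparr>carrier := ?K\<rparr>) ?X"
  proof (rule module_homI)
    fix y z assume "y \<in> carrier (regular_module R\<lparr>carrier := ?K\<rparr>)" "z \<in> carrier (regular_module R\<lparr>carrier := ?K\<rparr>)"
    then have "y \<in> carrier R" "z \<in> carrier R" by simp_all
    then show "f (y \<oplus>\<^bsub>regular_module R\<lparr>carrier := ?K\<rparr>\<^esub> z) = f y \<oplus>\<^bsub>?X\<^esub> f z"
      by (auto simp: fun_eq_iff f_def h l_distr)
  next
    fix r y assume "r \<in> carrier R" "y \<in> carrier (regular_module R\<lparr>carrier := ?K\<rparr>)"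
    then have "r \<in> carrier R" "y \<in> carrier R" by simp_all
    then show "f (r \<odot>\<^bsub>regular_module R\<lparr>carrier := ?K\<rparr>\<^esub> y) = r \<odot>\<^bsub>?X\<^esub> f y"
      by (auto simp: fun_eq_iff f_def m_ac)
  qed (simp add: fX)
  moreover have "f \<zero> = \<zero>\<^bsub>?X\<^esub>"
  proof -
    have "h \<zero> = 1" using haJ[OF J.zero_closed] aR by simp
    then show ?thesis by (simp add: f_def fun_eq_iff)
  qed
  ultimately obtain m where m: "m \<in> carrier ?X" "\<And>y. y \<in> ?K \<Longrightarrow> f y = y \<odot>\<^bsub>?X\<^esub> m"
    using inj K K.zero_closed unfolding baer_above_def by (metis empty_subsetI insert_subset singletonD)
  have "h a = f a \<one>" using aR by (simp add: f_def)
  also have "\<dots> = m a" using m(2)[of a] aR by (simp add: cgenideal_self)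
  also have "\<dots> = 1" using character_moduleD(4)[OF m(1) aJ] .
  finally show False using ha by simp
qed

end

theorem corollary4p4:
  fixes R :: "('a, 'r) ring_scheme"
  assumes "cring R"
    and "Pow (carrier R) \<lesssim> (UNIV :: 'm set)"
    and "no_middle_class TYPE('m) R"
  shows "artinian_cring R"
proof -
  interpret cring R by fact
  note dichotomy = no_middle_class_dichotomy[OF assms(2,3)]
  show ?thesis
  proof (rule artinian_if_no_decreasing_idempotents)
    fix J assume J: "ideal J R"
    have "carrier (character_module R J) \<lesssim> (UNIV :: 'm set)"
      using character_module_lepoll assms(2) by (rule lepoll_trans)
    then show "pure_ideal J \<or> semisimple_above R J"
      using dichotomy[OF J character_module[OF J] _ character_module_baer_above[OF J]]
        character_module_injective_imp_pure[OF J] by blast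
  next
    have "carrier R \<lesssim> Pow (carrier R)"
      unfolding lepoll_def by (intro exI[of _ "\<lambda>x. {x}"]) auto
    \<comment> \<open>This places modules whose elements come from \<open>R\<close> in the universe,
      in particular the ideal used against chains of idempotents.\<close>
    then have card: "carrier R \<lesssim> (UNIV :: 'm set)"
      using assms(2) by (rule lepoll_trans)
    fix f :: "nat \<Rightarrow> 'a"
    assume f: "f 0 = \<one>\<^bsub>R\<^esub>" "\<And>n. f n \<in> carrier R" "\<And>n. f n \<otimes>\<^bsub>R\<^esub> f n = f n"
      "\<And>n. f n \<otimes>\<^bsub>R\<^esub> f (Suc n) = f (Suc n)" "\<And>n. f (Suc n) \<noteq> f n"
    show False
    proof (rule no_decreasing_idempotents[of f, OF _ f])
      fix J and M :: "('a, 'a) module"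
      assume "ideal J R" "module R M" "carrier M \<subseteq> carrier R" "baer_above R J M"
      then show "semisimple_above R J \<or> baer_above R {\<zero>\<^bsub>R\<^esub>} M"
        using dichotomy[of J M] lepoll_trans[OF subset_imp_lepoll card] by blast
    qed
  qed
qed

end
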